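(* Let $Q=T[H_1,\dots,H_t]$ be a strong semicomplete composition with $n$ vertices. Then the smallest strong spanning subdigraph of $Q$ has precisely $n+\epsilon(Q)$ arcs.
   Context: Digraphs are finite, without loops or parallel arcs (2-cycles are allowed); cycles are directed. A digraph is semicomplete if there is at least one arc between every pair of distinct vertices. Let $T$ be a digraph with vertices $u_1,\dots,u_t$ ($t\ge 2$) and let $H_1,\dots,H_t$ be pairwise disjoint nonempty digraphs. The composition $Q=T[H_1,\dots,H_t]$ is the digraph with vertex set $\bigcup_i V(H_i)$ and arc set $\bigcup_{i=1}^t A(H_i)\cup\{xy : x\in V(H_i),\ y\in V(H_p),\ u_iu_p\in A(T)\}$. It is a semicomplete composition if $T$ is semicomplete. A digraph is strong if for every ordered pair of vertices $(x,y)$ there is a directed path from $x$ to $y$. The smallest strong spanning subdigraph of a strong digraph $D$ is a strong spanning subdigraph of $D$ with the fewest arcs. For a digraph $D$ and an integer $k\ge 0$, $H_k(D)$ is the digraph obtained from $D$ by adding $2k$ new vertices $x_1,\dots,x_k,y_1,\dots,y_k$, all arcs from every vertex of $D$ to each $x_i$, all arcs from each $y_i$ to every vertex of $D$, and all arcs $x_iy_j$, $i,j\in\{1,\dots,k\}$ (so $H_0(D)=D$). For a strong digraph $D$, $\epsilon(D)$ is the smallest $k\ge 0$ such that $H_k(D)$ is Hamiltonian, i.e., has a cycle containing all its vertices. *)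

theory Defs
  imports "Graph_Theory.Graph_Theory" "HOL-Library.Disjoint_Sets"
begin

definition semicomplete :: "'a pair_pre_digraph \<Rightarrow> bool" where
  "semicomplete D \<longleftrightarrow>
     (\<forall>u\<in>pverts D. \<forall>v\<in>pverts D. u \<noteq> v \<longrightarrow> (u, v) \<in> parcs D \<or> (v, u) \<in> parcs D)"

text \<open>The digraphs substituted into \<open>T\<close> are indexed by the vertices of \<open>T\<close> themselves:
  \<open>H u\<close> replaces the vertex \<open>u\<close>.\<close>

definition composition ::
  "'b pair_pre_digraph \<Rightarrow> ('b \<Rightarrow> 'a pair_pre_digraph) \<Rightarrow> 'a pair_pre_digraph" where
  "composition T H = \<lparr>
     pverts = (\<Union>u\<in>pverts T. pverts (H u)),
     parcs = (\<Union>u\<in>pverts T. parcs (H u)) \<union>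
       {(x, y) | x y u w. (u, w) \<in> parcs T \<and> x \<in> pverts (H u) \<and> y \<in> pverts (H w)}\<rparr>"

definition smallest_strong_spanning_subdigraph ::
  "('a, 'b) pre_digraph \<Rightarrow> ('a, 'b) pre_digraph \<Rightarrow> bool" where
  "smallest_strong_spanning_subdigraph S D \<longleftrightarrow>
     spanning S D \<and> strongly_connected S \<and>
     (\<forall>S'. spanning S' D \<and> strongly_connected S' \<longrightarrow> card (arcs S) \<le> card (arcs S'))"

text \<open>The argument \<open>u\<close> of \<^const>\<open>pre_digraph.awalk_verts\<close> only matters for the empty walk,
  which is not a cycle.\<close>

definition hamiltonian :: "('a, 'b) pre_digraph \<Rightarrow> bool" where
  "hamiltonian D \<longleftrightarrow>
     (\<exists>u p. pre_digraph.cycle D p \<and> set (pre_digraph.awalk_verts D u p) = verts D)"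

datatype 'a ext_vertex = Old 'a | X nat | Y nat

definition H_ext :: "nat \<Rightarrow> 'a pair_pre_digraph \<Rightarrow> 'a ext_vertex pair_pre_digraph" where
  "H_ext k D = \<lparr>
     pverts = Old ` pverts D \<union> X ` {1..k} \<union> Y ` {1..k},
     parcs = {(Old u, Old v) | u v. (u, v) \<in> parcs D} \<union>
       {(Old v, X i) | v i. v \<in> pverts D \<and> i \<in> {1..k}} \<union>
       {(Y i, Old v) | v i. v \<in> pverts D \<and> i \<in> {1..k}} \<union>
       {(X i, Y j) | i j. i \<in> {1..k} \<and> j \<in> {1..k}}\<rparr>"

text \<open>The minimum exists for every finite nonempty \<open>D\<close>: with \<open>k\<close> the number of vertices
  \<open>v\<^sub>1, \<dots>, v\<^sub>k\<close> of \<open>D\<close>, the closed walk \<open>v\<^sub>1 x\<^sub>1 y\<^sub>1 v\<^sub>2 x\<^sub>2 y\<^sub>2 \<dots> v\<^sub>k x\<^sub>k y\<^sub>k v\<^sub>1\<close> is a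
  Hamiltonian cycle.\<close>

definition epsilon :: "'a pair_pre_digraph \<Rightarrow> nat" where
  "epsilon D = (LEAST k. hamiltonian (with_proj (H_ext k D)))"

end

theory Submission
  imports Defs
begin

text \<open>
  A Hamiltonian cycle of \<open>H\<^sub>k(D)\<close> with \<open>k > 0\<close> is the same as a cover of \<open>D\<close> by \<open>k\<close> disjoint paths.
  A strong spanning subdigraph of a strong digraph on \<open>n\<close> vertices can be thinned to a cycle with
  \<open>j\<close> ears, which has \<open>n + j\<close> arcs. So the claim is that the least number of ears in an ear
  decomposition of \<open>Q\<close> is \<open>\<epsilon>(Q)\<close>.

  If \<open>j > 0\<close>, the cycle followed by its first ear is a path, which together with the interiors of the
  remaining ears gives a cover by \<open>j\<close> paths; hence \<open>\<epsilon>(Q) \<le> j\<close>.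

  Conversely, let \<open>k > 0\<close> paths cover \<open>Q\<close>, and contract their maximal runs inside the parts \<open>H u\<close>.
  Whenever a path visits a part twice, the section in between is split off as a cycle, until each
  of the \<open>k\<close> paths meets each part at most once. As \<open>T\<close> is strong and semicomplete, all these cycles
  can be merged into a single cycle, which can moreover be enlarged to meet every part. What remains
  of each of the \<open>k\<close> paths consists of pairwise adjacent vertices, so it can be rearranged as a path,
  and this path is an ear on the cycle because the cycle meets every part. So \<open>Q\<close> has an ear
  decomposition with at most \<open>k\<close> ears, and the case \<open>k = \<epsilon>(Q) > 0\<close> gives the upper bound.
\<close>

section \<open>Paths and cycles\<close>

definition dipath :: "'a rel \<Rightarrow> 'a list \<Rightarrow> bool" where
  "dipath A xs \<longleftrightarrow> distinct xs \<and> successively (\<lambda>x y. (x, y) \<in> A) xs"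

text \<open>A single vertex counts as a trivial cycle, so that single vertices and proper cycles can be
  absorbed into a larger cycle in the same way.\<close>

definition dicycle :: "'a rel \<Rightarrow> 'a list \<Rightarrow> bool" where
  "dicycle A c \<longleftrightarrow> c \<noteq> [] \<and> dipath A c \<and> (2 \<le> length c \<longrightarrow> (last c, hd c) \<in> A)"

definition path_on :: "'a rel \<Rightarrow> 'a set \<Rightarrow> bool" where
  "path_on A S \<longleftrightarrow> (\<exists>p. dipath A p \<and> set p = S)"

definition cycle_on :: "'a rel \<Rightarrow> 'a set \<Rightarrow> bool" where
  "cycle_on A C \<longleftrightarrow> (\<exists>c. dicycle A c \<and> set c = C)"

lemma path_onI: "dipath A p \<Longrightarrow> path_on A (set p)"
  by (auto simp: path_on_def)

lemma cycle_onI: "dicycle A c \<Longrightarrow> cycle_on A (set c)"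
  by (auto simp: cycle_on_def)

lemma dipath_Nil [simp]: "dipath A []"
  by (simp add: dipath_def)

lemma dipath_single [simp]: "dipath A [x]"
  by (simp add: dipath_def)

lemma dipath_append_iff:
  "dipath A (xs @ ys) \<longleftrightarrow> dipath A xs \<and> dipath A ys \<and> set xs \<inter> set ys = {} \<and>
     (xs \<noteq> [] \<longrightarrow> ys \<noteq> [] \<longrightarrow> (last xs, hd ys) \<in> A)"
  by (auto simp: dipath_def successively_append_iff)

lemma dipath_Cons_iff:
  "dipath A (x # xs) \<longleftrightarrow> x \<notin> set xs \<and> dipath A xs \<and> (xs \<noteq> [] \<longrightarrow> (x, hd xs) \<in> A)"
  by (auto simp: dipath_def successively_Cons)

lemma dipath_mono: "dipath A xs \<Longrightarrow> A \<subseteq> B \<Longrightarrow> dipath B xs"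
  by (auto simp: dipath_def intro: successively_mono)

lemma dicycle_Cons_iff:
  "dicycle A (x # xs) \<longleftrightarrow> dipath A (x # xs) \<and> (xs \<noteq> [] \<longrightarrow> (last xs, x) \<in> A)"
  by (cases xs) (auto simp: dicycle_def)

lemma dicycle_mono: "dicycle A c \<Longrightarrow> A \<subseteq> B \<Longrightarrow> dicycle B c"
  by (auto simp: dicycle_def intro: dipath_mono)

lemma cycle_on_mono: "cycle_on A C \<Longrightarrow> A \<subseteq> B \<Longrightarrow> cycle_on B C"
  by (auto simp: cycle_on_def intro: dicycle_mono)

lemma cycle_on_singleton: "cycle_on A {x}"
  using cycle_onI[of A "[x]"] by (simp add: dicycle_def)

lemma cycle_on_nonempty: "cycle_on A C \<Longrightarrow> C \<noteq> {}"
  by (auto simp: cycle_on_def dicycle_def)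

lemma cycle_on_finite: "cycle_on A C \<Longrightarrow> finite C"
  by (auto simp: cycle_on_def)

lemma dicycle_rotate:
  assumes "dicycle A (xs @ ys)"
  shows "dicycle A (ys @ xs)"
proof (cases "xs = [] \<or> ys = []")
  case False
  then have "2 \<le> length (xs @ ys)"
    by (cases xs; cases ys) auto
  with assms False show ?thesis
    by (auto simp: dicycle_def dipath_append_iff)
qed (use assms in auto)

lemma cycle_on_hdE:
  assumes "cycle_on A C" and "x \<in> C"
  obtains xs where "dicycle A (x # xs)" "set (x # xs) = C"
proof -
  obtain ys zs where "dicycle A (ys @ x # zs)" "set (ys @ x # zs) = C"
    using assms unfolding cycle_on_def by (metis split_list)
  then show ?thesis
    using dicycle_rotate[of A ys "x # zs"] by (intro that[of "zs @ ys"]) auto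
qed

lemma cycle_on_lastE:
  assumes "cycle_on A C" and "x \<in> C"
  obtains xs where "dicycle A (xs @ [x])" "set (xs @ [x]) = C"
proof -
  obtain ys zs where "dicycle A (ys @ x # zs)" "set (ys @ x # zs) = C"
    using assms unfolding cycle_on_def by (metis split_list)
  then show ?thesis
    using dicycle_rotate[of A "ys @ [x]" zs] by (intro that[of "zs @ ys"]) auto
qed

lemma dicycle_append:
  assumes "dicycle A c" and "dipath A r" and "r \<noteq> []" and "set c \<inter> set r = {}"
    and "(last c, hd r) \<in> A" and "(last r, hd c) \<in> A"
  shows "dicycle A (c @ r)"
  using assms by (auto simp: dicycle_def dipath_append_iff)

lemma cycle_on_Un_path:
  assumes "cycle_on A C" and "dipath A r" and "r \<noteq> []" and "C \<inter> set r = {}"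
    and "\<And>x. x \<in> C \<Longrightarrow> (x, hd r) \<in> A" and "\<And>x. x \<in> C \<Longrightarrow> (last r, x) \<in> A"
  shows "cycle_on A (C \<union> set r)"
proof -
  obtain c where c: "dicycle A c" "set c = C"
    using assms(1) unfolding cycle_on_def by blast
  then have "last c \<in> C" "hd c \<in> C"
    by (auto simp: dicycle_def)
  then have "dicycle A (c @ r)"
    using c assms by (intro dicycle_append) auto
  then show ?thesis
    using c(2) cycle_onI by fastforce
qed

lemma cycle_on_insert:
  assumes C: "cycle_on A C" and r: "r \<notin> C"
    and adj: "\<And>x. x \<in> C \<Longrightarrow> (x, r) \<in> A \<or> (r, x) \<in> A"
    and into: "a \<in> C" "(a, r) \<in> A" and out: "b \<in> C" "(r, b) \<in> A"
  shows "cycle_on A (insert r C)"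
proof -
  obtain xs where xs: "dicycle A (b # xs)" "set (b # xs) = C"
    using cycle_on_hdE[OF C out(1)] .
  have "\<exists>x\<in>set (b # xs). (x, r) \<in> A"
    using into xs(2) by blast
  then obtain ys x zs where split: "b # xs = ys @ x # zs"
      and x: "(x, r) \<in> A" and zs: "\<forall>z\<in>set zs. (z, r) \<notin> A"
    by (rule split_list_last_propE) blast
  define c where "c = zs @ ys @ [x]"
  have c: "dicycle A c" "set c = C"
    using dicycle_rotate[of A "ys @ [x]" zs] xs unfolding c_def split by auto
  have "(r, hd c) \<in> A"
  proof (cases zs)
    case Nil
    then have "hd c = b"
      using split by (metis append.left_neutral c_def list.sel(1))
    then show ?thesis using out(2) by simp
  next
    case (Cons z zs')
    then show ?thesis
      using adj[of z] zs c(2) unfolding c_def by auto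
  qed
  then have "dicycle A (c @ [r])"
    using c x r by (intro dicycle_append) (auto simp: c_def)
  then show ?thesis
    using c(2) cycle_onI by fastforce
qed

lemma semicomplete_path_on:
  assumes "finite M" and "\<And>x y. x \<in> M \<Longrightarrow> y \<in> M \<Longrightarrow> x \<noteq> y \<Longrightarrow> (x, y) \<in> A \<or> (y, x) \<in> A"
  shows "path_on A M"
  using assms
proof (induction M rule: finite_induct)
  case empty
  show ?case using path_onI[of A "[]"] by simp
next
  case (insert r M)
  then obtain xs where xs: "dipath A xs" "set xs = M"
    unfolding path_on_def by (metis insertCI)
  show ?case
  proof (cases "\<exists>x\<in>set xs. (x, r) \<in> A")
    case True
    then obtain ys x zs where split: "xs = ys @ x # zs" "(x, r) \<in> A" "\<forall>z\<in>set zs. (z, r) \<notin> A"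
      by (rule split_list_last_propE) blast
    have "zs \<noteq> [] \<Longrightarrow> (r, hd zs) \<in> A"
      using insert.prems[of r "hd zs"] split xs insert.hyps(2) by (cases zs) auto
    then have "dipath A (ys @ x # r # zs)"
      using xs split insert.hyps(2) by (auto simp: dipath_append_iff dipath_Cons_iff)
    then have "path_on A (set (ys @ x # r # zs))"
      by (rule path_onI)
    then show ?thesis using split xs by (auto simp: insert_commute)
  next
    case False
    have "xs \<noteq> [] \<Longrightarrow> (r, hd xs) \<in> A"
      using insert.prems[of r "hd xs"] False xs insert.hyps(2) by (cases xs) auto
    then have "dipath A (r # xs)"
      using xs insert.hyps(2) by (auto simp: dipath_Cons_iff)
    then show ?thesis using xs path_onI by fastforce
  qed
qed

lemma successively_concat_iff:
  assumes "[] \<notin> set xss"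
  shows "successively R (concat xss) \<longleftrightarrow>
    (\<forall>xs\<in>set xss. successively R xs) \<and> successively (\<lambda>xs ys. R (last xs) (hd ys)) xss"
  using assms
proof (induction xss)
  case (Cons xs xss)
  show ?case
  proof (cases xss)
    case (Cons ys yss)
    then have "concat xss \<noteq> []" "hd (concat xss) = hd ys"
      using Cons.prems by auto
    then show ?thesis
      using Cons.IH Cons.prems Cons by (auto simp: successively_append_iff)
  qed simp
qed simp

lemma dipath_concat_iff:
  assumes "[] \<notin> set ss"
  shows "dipath A (concat ss) \<longleftrightarrow>
    distinct (concat ss) \<and> (\<forall>s\<in>set ss. dipath A s) \<and> successively (\<lambda>s t. (last s, hd t) \<in> A) ss"
  unfolding dipath_def successively_concat_iff[OF assms] by (auto simp: distinct_concat_iff)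

lemma dicycle_concat:
  assumes "dipath A (concat ss)" and "ss \<noteq> []" and "[] \<notin> set ss"
    and "(last (last ss), hd (hd ss)) \<in> A"
  shows "dicycle A (concat ss)"
proof -
  have "hd (concat ss) = hd (hd ss)" "concat ss \<noteq> []"
    using assms(2,3) by (cases ss; auto)+
  moreover have "last (concat ss) = last (last ss)"
    using assms(2,3) by (cases ss rule: rev_cases) auto
  ultimately show ?thesis
    using assms(1,4) by (simp add: dicycle_def)
qed

section \<open>Strong digraphs\<close>

definition strong_on :: "'a set \<Rightarrow> 'a rel \<Rightarrow> bool" where
  "strong_on V B \<longleftrightarrow> (\<forall>u\<in>V. \<forall>v\<in>V. (u, v) \<in> B\<^sup>*)"

lemma strong_onD: "strong_on V B \<Longrightarrow> u \<in> V \<Longrightarrow> v \<in> V \<Longrightarrow> (u, v) \<in> B\<^sup>*"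
  by (simp add: strong_on_def)

lemma strong_on_mono: "strong_on V B \<Longrightarrow> B \<subseteq> B' \<Longrightarrow> strong_on V B'"
  unfolding strong_on_def using rtrancl_mono by blast

lemma strong_on_Un:
  assumes "strong_on V B" and "strong_on W B"
    and "x \<in> V" "y \<in> W" "(x, y) \<in> B" and "x' \<in> W" "y' \<in> V" "(x', y') \<in> B"
  shows "strong_on (V \<union> W) B"
proof -
  have "(u, x) \<in> B\<^sup>*" "(x, u) \<in> B\<^sup>*" if "u \<in> V \<union> W" for u
  proof -
    have "(x, y) \<in> B\<^sup>*" "(x', x) \<in> B\<^sup>*"
      using assms strong_onD[OF assms(1) assms(7) assms(3)]
      by (auto intro: converse_rtrancl_into_rtrancl)
    then show "(u, x) \<in> B\<^sup>*" "(x, u) \<in> B\<^sup>*"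
      using that assms(1-4,6) unfolding strong_on_def by (meson UnE rtrancl_trans)+
  qed
  then show ?thesis
    unfolding strong_on_def by (meson rtrancl_trans)
qed

lemma rtrancl_leaving_arc:
  assumes "(u, v) \<in> A\<^sup>*" and "u \<in> W" and "v \<notin> W"
  shows "\<exists>x\<in>W. \<exists>y. y \<notin> W \<and> (x, y) \<in> A"
  using assms by (induction rule: converse_rtrancl_induct) auto

lemma strong_on_leaving_arc:
  assumes "strong_on V A" and "A \<subseteq> V \<times> V" and "W \<subseteq> V" "W \<noteq> {}" "W \<noteq> V"
  obtains x y where "x \<in> W" "y \<in> V - W" "(x, y) \<in> A"
proof -
  obtain u v where "u \<in> W" "v \<in> V - W"
    using assms(3-5) by blast
  then have "\<exists>x\<in>W. \<exists>y. y \<notin> W \<and> (x, y) \<in> A"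
    using assms(1,3) by (intro rtrancl_leaving_arc[of u v]) (auto dest: strong_onD)
  then show ?thesis
    using assms(2) that by blast
qed

definition ear_arcs :: "'a \<Rightarrow> 'a list \<Rightarrow> 'a \<Rightarrow> 'a rel" where
  "ear_arcs a r b = set (zip (a # r) (r @ [b]))"

lemma ear_arcs_Nil [simp]: "ear_arcs a [] b = {(a, b)}"
  by (simp add: ear_arcs_def)

lemma ear_arcs_Cons [simp]: "ear_arcs a (x # r) b = insert (a, x) (ear_arcs x r b)"
  by (simp add: ear_arcs_def)

lemma finite_ear_arcs [simp]: "finite (ear_arcs a r b)"
  by (simp add: ear_arcs_def)

lemma card_ear_arcs: "distinct (a # r) \<Longrightarrow> card (ear_arcs a r b) = length r + 1"
  unfolding ear_arcs_def by (subst distinct_card) (auto simp: distinct_zipI1)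

lemma ear_arcs_subset:
  "dipath A r \<Longrightarrow> r \<noteq> [] \<Longrightarrow> (a, hd r) \<in> A \<Longrightarrow> (last r, b) \<in> A \<Longrightarrow> ear_arcs a r b \<subseteq> A"
proof (induction r arbitrary: a)
  case (Cons x r)
  then show ?case by (cases "r = []") (auto simp: dipath_Cons_iff)
qed simp

lemma ear_arcs_subset_Times: "ear_arcs a r b \<subseteq> insert a (set r) \<times> insert b (set r)"
  by (induction r arbitrary: a) auto

lemma ear_arcs_Int_Times:
  "r \<noteq> [] \<Longrightarrow> set r \<inter> W = {} \<Longrightarrow> ear_arcs a r b \<inter> W \<times> W = {}"
proof (induction r arbitrary: a)
  case (Cons x r)
  then show ?case by (cases "r = []") auto
qed simp

lemma ear_arcs_reach_from: "x \<in> set r \<union> {b} \<Longrightarrow> (a, x) \<in> (ear_arcs a r b)\<^sup>*"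
proof (induction r arbitrary: a)
  case (Cons y r)
  have "(ear_arcs y r b)\<^sup>* \<subseteq> (ear_arcs a (y # r) b)\<^sup>*"
    by (rule rtrancl_mono) auto
  then have "(y, x) \<in> (ear_arcs a (y # r) b)\<^sup>*"
    using Cons.IH[of y] Cons.prems by (cases "x = y") auto
  then show ?case by (rule converse_rtrancl_into_rtrancl[rotated]) simp
qed auto

lemma ear_arcs_reach_to: "x \<in> set r \<union> {a} \<Longrightarrow> (x, b) \<in> (ear_arcs a r b)\<^sup>*"
proof (induction r arbitrary: a)
  case (Cons y r)
  have "(ear_arcs y r b)\<^sup>* \<subseteq> (ear_arcs a (y # r) b)\<^sup>*"
    by (rule rtrancl_mono) auto
  then show ?case
    using Cons.IH[of y] Cons.prems ear_arcs_reach_from[of b "y # r" b a] by (cases "x = a") auto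
qed auto

lemma strong_on_Un_ear:
  assumes "strong_on W B" and ab: "a \<in> W" "b \<in> W"
  shows "strong_on (W \<union> set r) (B \<union> ear_arcs a r b)"
proof -
  let ?B = "B \<union> ear_arcs a r b"
  have W: "(u, v) \<in> ?B\<^sup>*" if "u \<in> W" "v \<in> W" for u v
    using strong_on_mono[OF assms(1), of ?B] that by (auto dest: strong_onD)
  have ear: "(ear_arcs a r b)\<^sup>* \<subseteq> ?B\<^sup>*"
    by (rule rtrancl_mono) auto
  have from_a: "(a, v) \<in> ?B\<^sup>*" if "v \<in> W \<union> set r" for v
    using that W[OF ab(1)] ear_arcs_reach_from[of v r b a] ear by auto
  have to_b: "(u, b) \<in> ?B\<^sup>*" if "u \<in> W \<union> set r" for u
    using that W[OF _ ab(2)] ear_arcs_reach_to[of u r a b] ear by auto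
  show ?thesis
    unfolding strong_on_def using from_a to_b W[OF ab(2,1)] by (meson rtrancl_trans)
qed

lemma cycle_on_strong_subdigraph:
  assumes "cycle_on A C" and "2 \<le> card C"
  obtains B where "B \<subseteq> A \<inter> C \<times> C" "card B = card C" "strong_on C B"
proof -
  obtain x where "x \<in> C"
    using assms(2) by fastforce
  then obtain xs where xs: "dicycle A (x # xs)" "set (x # xs) = C"
    using cycle_on_hdE[OF assms(1)] by blast
  have dist: "distinct (x # xs)"
    using xs(1) by (simp add: dicycle_def dipath_def)
  then have "length (x # xs) = card C"
    using xs(2) distinct_card by metis
  then have card: "card (ear_arcs x xs x) = card C" and "xs \<noteq> []"
    using dist assms(2) by (auto simp: card_ear_arcs)
  then have "ear_arcs x xs x \<subseteq> A"
    using xs(1) by (intro ear_arcs_subset) (auto simp: dicycle_Cons_iff dipath_Cons_iff)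
  moreover have "ear_arcs x xs x \<subseteq> C \<times> C"
    using ear_arcs_subset_Times[of x xs x] xs(2) by auto
  moreover have "strong_on C (ear_arcs x xs x)"
    using strong_on_Un_ear[of "{x}" "{}" x x xs] unfolding xs(2)[symmetric]
    by (simp add: strong_on_def)
  ultimately show ?thesis
    using card by (intro that) auto
qed

lemma cycle_on_imp_strong_on:
  assumes "cycle_on A C"
  shows "strong_on C (A \<inter> C \<times> C)"
proof (cases "2 \<le> card C")
  case True
  then show ?thesis
    using cycle_on_strong_subdigraph[OF assms] strong_on_mono by metis
next
  case False
  then have "x = y" if "x \<in> C" "y \<in> C" for x y
    using that cycle_on_finite[OF assms] card_le_Suc0_iff_eq[of C] by auto
  then show ?thesis
    by (auto simp: strong_on_def)
qed

section \<open>Absorbing cycles into a cycle\<close>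

lemma strong_on_dominated_to_dominating:
  assumes strong: "strong_on (C \<union> \<Union>\<R>) (A \<inter> (C \<union> \<Union>\<R>) \<times> (C \<union> \<Union>\<R>))"
    and nonempty: "C \<noteq> {}" "\<Union>\<R> \<noteq> {}" and disj: "C \<inter> \<Union>\<R> = {}"
    and adj: "\<And>x y. x \<in> C \<Longrightarrow> y \<in> \<Union>\<R> \<Longrightarrow> (x, y) \<in> A \<or> (y, x) \<in> A"
    and one_way: "\<And>R x y x' y'. R \<in> \<R> \<Longrightarrow> x \<in> C \<Longrightarrow> y \<in> R \<Longrightarrow> (x, y) \<in> A \<Longrightarrow>
      x' \<in> C \<Longrightarrow> y' \<in> R \<Longrightarrow> (y', x') \<notin> A"
  obtains R R' x y where "R \<in> \<R>" "R' \<in> \<R>" "R \<noteq> R'" "x \<in> R" "y \<in> R'" "(x, y) \<in> A"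
    "C \<times> R \<subseteq> A" "R' \<times> C \<subseteq> A"
proof -
  define D where "D = \<Union>{R \<in> \<R>. \<exists>u\<in>C. \<exists>v\<in>R. (u, v) \<in> A}"
  have "D \<noteq> {}"
  proof -
    obtain u v where "u \<in> C" "v \<in> (C \<union> \<Union>\<R>) - C" "(u, v) \<in> A \<inter> (C \<union> \<Union>\<R>) \<times> (C \<union> \<Union>\<R>)"
      using nonempty disj by (rule_tac strong_on_leaving_arc[OF strong, of C]) blast+
    then show ?thesis
      unfolding D_def by blast
  qed
  moreover have "D \<subseteq> C \<union> \<Union>\<R>" "D \<noteq> C \<union> \<Union>\<R>"
    unfolding D_def using nonempty(1) disj by blast+
  ultimately obtain x y where x: "x \<in> D" and y: "y \<in> (C \<union> \<Union>\<R>) - D" and xy: "(x, y) \<in> A"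
    using strong_on_leaving_arc[OF strong Int_lower2, of D] by (metis IntD1)
  obtain R u v where R: "R \<in> \<R>" "x \<in> R" "u \<in> C" "v \<in> R" "(u, v) \<in> A"
    using x unfolding D_def by blast
  have "y \<notin> C"
    using one_way[OF R(1,3-5) _ R(2)] xy by blast
  then obtain R' where R': "R' \<in> \<R>" "y \<in> R'"
    using y by blast
  then have "(u, v) \<notin> A" if "u \<in> C" "v \<in> R'" for u v
    using y that unfolding D_def by blast
  then have "R' \<times> C \<subseteq> A"
    using adj R'(1) by blast
  moreover have "C \<times> R \<subseteq> A"
    using one_way[OF R(1,3-5)] adj R(1) by blast
  moreover have "R \<noteq> R'"
    using x y R R' unfolding D_def by blast
  ultimately show ?thesis
    using that R R' xy by blast
qed

lemma cycle_on_Un_dominated_dominating: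
  assumes C: "cycle_on A C" and B: "cycle_on A B" and B': "cycle_on A B'"
    and disj: "C \<inter> B = {}" "C \<inter> B' = {}" "B \<inter> B' = {}"
    and dom: "C \<times> B \<subseteq> A" "B' \<times> C \<subseteq> A"
    and xy: "x \<in> B" "y \<in> B'" "(x, y) \<in> A"
  shows "cycle_on A (C \<union> (B \<union> B'))"
proof -
  obtain xs where xs: "dicycle A (xs @ [x])" "set (xs @ [x]) = B"
    using cycle_on_lastE[OF B xy(1)] .
  obtain ys where ys: "dicycle A (y # ys)" "set (y # ys) = B'"
    using cycle_on_hdE[OF B' xy(2)] .
  define r where "r = (xs @ [x]) @ (y # ys)"
  have set_r: "set r = B \<union> B'"
    using xs(2) ys(2) by (auto simp: r_def)
  have "dipath A r"
    using xs ys disj(3) xy(3) unfolding r_def dipath_append_iff[of A "xs @ [x]"]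
    by (simp add: dicycle_def)
  moreover have "hd r \<in> B" "last r \<in> B'"
    using xs(2) ys(2) unfolding r_def by (cases xs; auto)+
  ultimately have "cycle_on A (C \<union> set r)"
    using C disj(1,2) dom by (intro cycle_on_Un_path) (auto simp: set_r, simp add: r_def)
  then show ?thesis
    by (simp add: set_r)
qed

text \<open>If no member of \<open>\<R>\<close> can be absorbed on its own, then each of them is completely dominated by
  \<open>C\<close> or completely dominates it. Strong connectivity yields an arc from one of the first kind to
  one of the second kind, and these two together fit into any arc of \<open>C\<close>.\<close>

lemma cycle_on_absorb_some:
  assumes C: "cycle_on A C" and blocks: "\<And>R. R \<in> \<R> \<Longrightarrow> cycle_on A R" and "\<R> \<noteq> {}"
    and disj: "disjoint \<R>" "C \<inter> \<Union>\<R> = {}"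
    and strong: "strong_on (C \<union> \<Union>\<R>) (A \<inter> (C \<union> \<Union>\<R>) \<times> (C \<union> \<Union>\<R>))"
    and adj: "\<And>x y. x \<in> C \<Longrightarrow> y \<in> \<Union>\<R> \<Longrightarrow> (x, y) \<in> A \<or> (y, x) \<in> A"
    and absorb: "\<And>R x y x' y'. R \<in> \<R> \<Longrightarrow> x \<in> C \<Longrightarrow> y \<in> R \<Longrightarrow> (x, y) \<in> A \<Longrightarrow>
      x' \<in> C \<Longrightarrow> y' \<in> R \<Longrightarrow> (y', x') \<in> A \<Longrightarrow> cycle_on A (C \<union> R)"
  obtains \<D> where "\<D> \<subseteq> \<R>" "\<D> \<noteq> {}" "cycle_on A (C \<union> \<Union>\<D>)"
proof (cases "\<exists>R\<in>\<R>. cycle_on A (C \<union> R)")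
  case True
  then obtain R where "R \<in> \<R>" "cycle_on A (C \<union> R)"
    by blast
  then show ?thesis
    using that[of "{R}"] by simp
next
  case False
  have "\<Union>\<R> \<noteq> {}"
    using \<open>\<R> \<noteq> {}\<close> blocks cycle_on_nonempty by fastforce
  have one_way: "(y', x') \<notin> A"
    if "R \<in> \<R>" "x \<in> C" "y \<in> R" "(x, y) \<in> A" "x' \<in> C" "y' \<in> R" for R x y x' y'
    using absorb[OF that] False that(1) by blast
  obtain R R' x y where R: "R \<in> \<R>" "R' \<in> \<R>" "R \<noteq> R'" "x \<in> R" "y \<in> R'" "(x, y) \<in> A"
    "C \<times> R \<subseteq> A" "R' \<times> C \<subseteq> A"
    by (rule strong_on_dominated_to_dominating[OF strong cycle_on_nonempty[OF C]
          \<open>\<Union>\<R> \<noteq> {}\<close> disj(2) adj one_way])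
      blast
  have "C \<inter> R = {}" "C \<inter> R' = {}" "R \<inter> R' = {}"
    using R(1-3) disj by (auto dest: disjointD)
  then have "cycle_on A (C \<union> (R \<union> R'))"
    using R blocks by (intro cycle_on_Un_dominated_dominating[OF C]) auto
  then show ?thesis
    using that[of "{R, R'}"] R(1,2) by simp
qed

lemma cycle_on_absorb_vertices:
  assumes C: "cycle_on A C" and "M \<noteq> {}" and disj: "C \<inter> M = {}"
    and strong: "strong_on (C \<union> M) (A \<inter> (C \<union> M) \<times> (C \<union> M))"
    and adj: "\<And>x y. x \<in> C \<Longrightarrow> y \<in> M \<Longrightarrow> (x, y) \<in> A \<or> (y, x) \<in> A"
  obtains S where "S \<subseteq> M" "S \<noteq> {}" "cycle_on A (C \<union> S)"
proof -
  define \<R> where "\<R> = (\<lambda>r. {r}) ` M"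
  have \<R>: "\<R> \<noteq> {}" "disjoint \<R>" "\<Union>\<R> = M"
    using \<open>M \<noteq> {}\<close> by (auto simp: \<R>_def disjoint_def)
  obtain \<D> where \<D>: "\<D> \<subseteq> \<R>" "\<D> \<noteq> {}" "cycle_on A (C \<union> \<Union>\<D>)"
  proof (rule cycle_on_absorb_some[OF C _ \<R>(1,2)])
    show "cycle_on A R" if "R \<in> \<R>" for R
      using that by (auto simp: \<R>_def cycle_on_singleton)
    show "cycle_on A (C \<union> R)"
      if "R \<in> \<R>" "x \<in> C" "y \<in> R" "(x, y) \<in> A" "x' \<in> C" "y' \<in> R" "(y', x') \<in> A" for R x y x' y'
    proof -
      have "R = {y}" "y' = y" "y \<in> M"
        using that(1,3,6) by (auto simp: \<R>_def)
      moreover have "cycle_on A (insert y C)"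
        using that(2,4,5,7) \<open>y' = y\<close> \<open>y \<in> M\<close> disj adj
        by (intro cycle_on_insert[OF C, of y x x']) auto
      ultimately show ?thesis by simp
    qed
  qed (use disj strong adj in \<open>simp_all add: \<R>(3)\<close>)
  then have "\<Union>\<D> \<noteq> {}" "\<Union>\<D> \<subseteq> M"
    by (auto simp: \<R>_def)
  then show ?thesis
    using that \<D>(3) by blast
qed

lemma cycle_on_Un:
  assumes C: "cycle_on A C" and B: "cycle_on A B" and disj: "C \<inter> B = {}"
    and adj: "\<And>x y. x \<in> C \<union> B \<Longrightarrow> y \<in> B \<Longrightarrow> x \<noteq> y \<Longrightarrow> (x, y) \<in> A \<or> (y, x) \<in> A"
    and into: "x \<in> C" "y \<in> B" "(x, y) \<in> A" and out: "x' \<in> C" "y' \<in> B" "(y', x') \<in> A"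
  shows "cycle_on A (C \<union> B)"
proof -
  define \<S> where "\<S> = {S. S \<subseteq> B \<and> cycle_on A (C \<union> S)}"
  have "finite \<S>" "{} \<in> \<S>"
    using C cycle_on_finite[OF B] unfolding \<S>_def by auto
  then obtain S where "S \<in> \<S>" and max: "\<forall>S'\<in>\<S>. S \<subseteq> S' \<longrightarrow> S = S'"
    using finite_has_maximal2[of \<S> "{}"] by blast
  then have S: "S \<subseteq> B" "cycle_on A (C \<union> S)"
    unfolding \<S>_def by auto
  let ?A = "A \<inter> (C \<union> B) \<times> (C \<union> B)"
  have strong: "strong_on (C \<union> B) ?A"
  proof (rule strong_on_Un)
    show "strong_on C ?A"
      by (rule strong_on_mono[OF cycle_on_imp_strong_on[OF C]]) blast
    show "strong_on B ?A"
      by (rule strong_on_mono[OF cycle_on_imp_strong_on[OF B]]) blast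
    show "(x, y) \<in> ?A" "(y', x') \<in> ?A"
      using into out by auto
  qed (fact into out)+
  have "S = B"
  proof (rule ccontr)
    assume "S \<noteq> B"
    then have rest: "B - S \<noteq> {}" "(C \<union> S) \<union> (B - S) = C \<union> B" "(C \<union> S) \<inter> (B - S) = {}"
      using S(1) disj by auto
    obtain S' where "S' \<subseteq> B - S" "S' \<noteq> {}" "cycle_on A ((C \<union> S) \<union> S')"
    proof (rule cycle_on_absorb_vertices[OF S(2) rest(1,3)])
      show "(u, v) \<in> A \<or> (v, u) \<in> A" if "u \<in> C \<union> S" "v \<in> B - S" for u v
        using that S(1) disj by (intro adj) auto
    qed (simp only: rest(2) strong)
    then have "S \<union> S' \<in> \<S>" "\<not> S' \<subseteq> S"
      using S(1) unfolding \<S>_def by (auto simp: Un_assoc)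
    then show False
      using max by blast
  qed
  then show ?thesis using S(2) by simp
qed

section \<open>Blow-ups of strong semicomplete digraphs\<close>

text \<open>The blow-up of \<open>E\<close> in which \<open>\<pi>\<close> sends every vertex to the vertex that it is a copy of has the
  arcs \<open>inv_image E \<pi>\<close>.\<close>

lemma cycle_on_splice:
  assumes C: "cycle_on (inv_image E \<pi>) C" "2 \<le> card C"
    and B: "cycle_on (inv_image E \<pi>) B" "2 \<le> card B"
    and disj: "C \<inter> B = {}" and xy: "x \<in> C" "y \<in> B" "\<pi> x = \<pi> y"
  shows "cycle_on (inv_image E \<pi>) (C \<union> B)"
proof -
  obtain xs where xs: "dicycle (inv_image E \<pi>) (x # xs)" "set (x # xs) = C"
    using cycle_on_hdE[OF C(1) xy(1)] .
  obtain ys where ys: "dicycle (inv_image E \<pi>) (y # ys)" "set (y # ys) = B"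
    using cycle_on_hdE[OF B(1) xy(2)] .
  have "xs \<noteq> []" "ys \<noteq> []"
    using xs(2) ys(2) C(2) B(2) by auto
  then have "dicycle (inv_image E \<pi>) ((x # xs) @ (y # ys))"
    using xs ys disj xy(3) dicycle_append[OF xs(1), of "y # ys"] by (auto simp: dicycle_Cons_iff)
  then show ?thesis
    using cycle_onI xs(2) ys(2) by (metis set_append)
qed

lemma splice_block:
  assumes \<B>: "disjoint \<B>" "\<C> \<subseteq> \<B>" "B \<in> \<B> - \<C>"
    and \<C>: "cycle_on (inv_image E \<pi>) (\<Union>\<C>)" "2 \<le> card (\<Union>\<C>)"
    and B: "cycle_on (inv_image E \<pi>) B" "2 \<le> card B" "\<pi> ` \<Union>\<C> \<inter> \<pi> ` B \<noteq> {}"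
  shows "cycle_on (inv_image E \<pi>) (\<Union>\<C> \<union> B)"
proof -
  have "B' \<inter> B = {}" if "B' \<in> \<C>" for B'
    using disjointD[OF \<B>(1), of B' B] that \<B>(2,3) by blast
  then have "\<Union>\<C> \<inter> B = {}"
    by blast
  moreover obtain x y where "x \<in> \<Union>\<C>" "y \<in> B" "\<pi> x = \<pi> y"
    using B(3) by fastforce
  ultimately show ?thesis
    using cycle_on_splice[OF \<C> B(1,2)] by simp
qed

locale strong_semicomplete =
  fixes E :: "'b rel" and P :: "'b set"
  assumes arcs_subset: "E \<subseteq> P \<times> P"
    and irrefl: "(u, u) \<notin> E"
    and adjacent: "u \<in> P \<Longrightarrow> v \<in> P \<Longrightarrow> u \<noteq> v \<Longrightarrow> (u, v) \<in> E \<or> (v, u) \<in> E"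
    and strong: "strong_on P E"
    and card_P: "2 \<le> card P"
begin

lemma ex_out_arc:
  assumes "u \<in> P"
  obtains v where "v \<in> P" "(u, v) \<in> E"
proof -
  have "{u} \<noteq> P"
    using card_P by auto
  then show ?thesis
    using strong_on_leaving_arc[OF strong arcs_subset, of "{u}"] assms that by blast
qed

lemma ex_in_arc:
  assumes "u \<in> P"
  obtains v where "v \<in> P" "(v, u) \<in> E"
proof -
  have "P - {u} \<noteq> {}"
  proof
    assume "P - {u} = {}"
    then have "P = {u}"
      using assms by blast
    then show False
      using card_P by simp
  qed
  then show ?thesis
    using strong_on_leaving_arc[OF strong arcs_subset, of "P - {u}"] assms that by blast
qed

lemma strong_on_blowup:
  assumes \<pi>W: "\<pi> ` W = P"
  shows "strong_on W (inv_image E \<pi> \<inter> W \<times> W)"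
proof -
  have lift: "(x, y) \<in> (inv_image E \<pi> \<inter> W \<times> W)\<^sup>*"
    if "(u, v) \<in> E\<^sup>+" "x \<in> W" "y \<in> W" "\<pi> x = u" "\<pi> y = v" for u v x y
    using that
  proof (induction arbitrary: y rule: trancl_induct)
    case (base v)
    then show ?case by auto
  next
    case (step v w)
    then have "v \<in> \<pi> ` W"
      using \<pi>W arcs_subset by blast
    then obtain z where z: "z \<in> W" "\<pi> z = v"
      by blast
    then have "(x, z) \<in> (inv_image E \<pi> \<inter> W \<times> W)\<^sup>*"
      using step.IH step.prems by blast
    moreover have "(z, y) \<in> inv_image E \<pi> \<inter> W \<times> W"
      using step z by simp
    ultimately show ?case
      by (rule rtrancl_into_rtrancl)
  qed
  have "(u, v) \<in> E\<^sup>+" if "u \<in> P" "v \<in> P" for u v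
  proof -
    obtain w where "w \<in> P" "(u, w) \<in> E"
      using ex_out_arc[OF \<open>u \<in> P\<close>] .
    then show ?thesis
      using strong_onD[OF strong] \<open>v \<in> P\<close> by (auto intro: rtrancl_into_trancl2)
  qed
  then show ?thesis
    unfolding strong_on_def
  proof (intro ballI)
    fix x y assume "x \<in> W" "y \<in> W"
    then show "(x, y) \<in> (inv_image E \<pi> \<inter> W \<times> W)\<^sup>*"
      using \<pi>W \<open>\<And>u v. u \<in> P \<Longrightarrow> v \<in> P \<Longrightarrow> (u, v) \<in> E\<^sup>+\<close> by (intro lift) auto
  qed
qed

definition transversal_cycle :: "('c \<Rightarrow> 'b) \<Rightarrow> 'c set \<Rightarrow> bool" where
  "transversal_cycle \<pi> B \<longleftrightarrow> cycle_on (inv_image E \<pi>) B \<and> inj_on \<pi> B"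

lemma absorb_new_parts:
  assumes C: "cycle_on (inv_image E \<pi>) C" and "\<R> \<noteq> {}" and "disjoint \<R>"
    and \<R>: "\<And>R. R \<in> \<R> \<Longrightarrow> transversal_cycle \<pi> R" and new: "\<And>R. R \<in> \<R> \<Longrightarrow> \<pi> ` C \<inter> \<pi> ` R = {}"
    and cover: "\<pi> ` (C \<union> \<Union>\<R>) = P"
  obtains \<D> where "\<D> \<subseteq> \<R>" "\<D> \<noteq> {}" "cycle_on (inv_image E \<pi>) (C \<union> \<Union>\<D>)"
proof (rule cycle_on_absorb_some[OF C _ \<open>\<R> \<noteq> {}\<close> \<open>disjoint \<R>\<close> _ strong_on_blowup[OF cover]])
  show cyc: "cycle_on (inv_image E \<pi>) R" if "R \<in> \<R>" for R
    using \<R>[OF that] by (simp add: transversal_cycle_def)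
  show "C \<inter> \<Union>\<R> = {}"
    using new by blast
  have adj: "(x, y) \<in> inv_image E \<pi> \<or> (y, x) \<in> inv_image E \<pi>"
    if "x \<in> C \<union> \<Union>\<R>" "y \<in> \<Union>\<R>" "\<pi> x \<noteq> \<pi> y" for x y
    using adjacent[of "\<pi> x" "\<pi> y"] that cover by (simp, blast)
  show "(x, y) \<in> inv_image E \<pi> \<or> (y, x) \<in> inv_image E \<pi>" if "x \<in> C" "y \<in> \<Union>\<R>" for x y
    using that adj[of x y] new by blast
  show "cycle_on (inv_image E \<pi>) (C \<union> R)"
    if R: "R \<in> \<R>" and arcs: "x \<in> C" "y \<in> R" "(x, y) \<in> inv_image E \<pi>"
      "x' \<in> C" "y' \<in> R" "(y', x') \<in> inv_image E \<pi>" for R x y x' y'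
  proof (rule cycle_on_Un[OF C cyc[OF R] _ _ arcs])
    show "C \<inter> R = {}"
      using new[OF R] by blast
    show "(u, v) \<in> inv_image E \<pi> \<or> (v, u) \<in> inv_image E \<pi>" if "u \<in> C \<union> R" "v \<in> R" "u \<noteq> v" for u v
    proof -
      have "inj_on \<pi> R"
        using \<R>[OF R] by (simp add: transversal_cycle_def)
      then have "\<pi> u \<noteq> \<pi> v"
        using that new[OF R] by (auto dest: inj_onD)
      then show ?thesis
        using adj[of u v] that R by blast
    qed
  qed
qed (use that in blast)+

lemma image_Un_blocks_in_new_parts:
  assumes blocks: "\<And>B. B \<in> \<B> \<Longrightarrow> transversal_cycle \<pi> B" and "\<C> \<subseteq> \<B>"
    and large: "\<And>B. B \<in> \<B> - \<C> \<Longrightarrow> 2 \<le> card B \<Longrightarrow> \<pi> ` \<Union>\<C> \<inter> \<pi> ` B = {}"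
  shows "\<pi> ` (\<Union>\<C> \<union> \<Union>{B \<in> \<B>. \<pi> ` \<Union>\<C> \<inter> \<pi> ` B = {}}) = \<pi> ` \<Union>\<B>" (is "\<pi> ` (_ \<union> \<Union>?\<R>) = _")
proof -
  have "\<pi> ` B \<subseteq> \<pi> ` (\<Union>\<C> \<union> \<Union>?\<R>)" if B: "B \<in> \<B>" for B
  proof (cases "B \<in> \<C> \<or> B \<in> ?\<R>")
    case True
    then show ?thesis by blast
  next
    case False
    then have meets: "\<pi> ` \<Union>\<C> \<inter> \<pi> ` B \<noteq> {}" and "\<not> 2 \<le> card B"
      using large[of B] B by auto
    moreover have "card B \<noteq> 0"
      using blocks[OF B] cycle_on_finite cycle_on_nonempty unfolding transversal_cycle_def by fastforce
    ultimately have "card B = 1"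
      by simp
    then obtain y where "B = {y}"
      by (rule card_1_singletonE)
    then show ?thesis
      using meets by auto
  qed
  then show ?thesis
    using \<open>\<C> \<subseteq> \<B>\<close> by blast
qed

text \<open>A block with at least two vertices can be spliced in if it meets a part that the cycle meets
  as well. If there is no such block, then those avoiding all these parts can be absorbed.\<close>

lemma enlarge_cycle_of_blocks:
  assumes \<B>: "disjoint \<B>" "\<And>B. B \<in> \<B> \<Longrightarrow> transversal_cycle \<pi> B" "\<pi> ` \<Union>\<B> = P"
    and \<C>: "\<C> \<subseteq> \<B>" "cycle_on (inv_image E \<pi>) (\<Union>\<C>)"
    and large: "\<forall>B\<in>\<B>. 2 \<le> card B \<longrightarrow> 2 \<le> card (\<Union>\<C>)"
    and incomplete: "\<pi> ` \<Union>\<C> \<noteq> P \<or> (\<exists>B\<in>\<B> - \<C>. 2 \<le> card B)"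
  obtains \<D> where "\<D> \<subseteq> \<B>" "\<not> \<D> \<subseteq> \<C>" "cycle_on (inv_image E \<pi>) (\<Union>\<C> \<union> \<Union>\<D>)"
proof (cases "\<exists>B\<in>\<B> - \<C>. 2 \<le> card B \<and> \<pi> ` \<Union>\<C> \<inter> \<pi> ` B \<noteq> {}")
  case True
  then obtain B where B: "B \<in> \<B> - \<C>" "2 \<le> card B" "\<pi> ` \<Union>\<C> \<inter> \<pi> ` B \<noteq> {}"
    by blast
  moreover have "cycle_on (inv_image E \<pi>) B" "2 \<le> card (\<Union>\<C>)"
    using \<B>(2)[of B] large B(1,2) by (auto simp: transversal_cycle_def)
  ultimately have "cycle_on (inv_image E \<pi>) (\<Union>\<C> \<union> B)"
    using \<B>(1) \<C> by (intro splice_block)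
  then show ?thesis
    using that[of "{B}"] B(1) by simp
next
  case False
  define \<R> where "\<R> = {B \<in> \<B>. \<pi> ` \<Union>\<C> \<inter> \<pi> ` B = {}}"
  have cover: "\<pi> ` (\<Union>\<C> \<union> \<Union>\<R>) = P"
    unfolding \<R>_def using image_Un_blocks_in_new_parts[OF \<B>(2) \<C>(1)] \<B>(3) False by simp
  have "\<R> \<noteq> {}"
    using incomplete False cover unfolding \<R>_def by auto
  have "disjoint \<R>"
    using pairwise_subset[OF \<B>(1)] by (simp add: \<R>_def)
  obtain \<D> where \<D>: "\<D> \<subseteq> \<R>" "\<D> \<noteq> {}" "cycle_on (inv_image E \<pi>) (\<Union>\<C> \<union> \<Union>\<D>)"
  proof (rule absorb_new_parts[OF \<C>(2) \<open>\<R> \<noteq> {}\<close> \<open>disjoint \<R>\<close> _ _ cover])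
    show "transversal_cycle \<pi> R" "\<pi> ` \<Union>\<C> \<inter> \<pi> ` R = {}" if "R \<in> \<R>" for R
      using that \<B>(2) unfolding \<R>_def by simp_all
  qed
  moreover have "B \<notin> \<C>" if "B \<in> \<R>" for B
  proof
    assume "B \<in> \<C>"
    then have "\<pi> ` B \<subseteq> \<pi> ` \<Union>\<C>"
      by blast
    moreover have "B \<noteq> {}"
      using that \<B>(2) cycle_on_nonempty by (auto simp: \<R>_def transversal_cycle_def)
    ultimately show False
      using that by (auto simp: \<R>_def)
  qed
  moreover have "\<R> \<subseteq> \<B>"
    unfolding \<R>_def by blast
  ultimately show ?thesis
    by (intro that[of \<D>]) auto
qed

lemma merge_blocks:
  assumes "finite \<B>" and \<B>: "disjoint \<B>" "\<And>B. B \<in> \<B> \<Longrightarrow> transversal_cycle \<pi> B" "\<pi> ` \<Union>\<B> = P"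
  obtains C where "C \<subseteq> \<Union>\<B>" "cycle_on (inv_image E \<pi>) C" "\<pi> ` C = P"
    "\<forall>B\<in>\<B>. 2 \<le> card B \<longrightarrow> B \<subseteq> C"
proof -
  have "\<B> \<noteq> {}"
    using \<B>(3) card_P by auto
  then obtain B0 where B0: "B0 \<in> \<B>" "2 \<le> card B0 \<or> (\<forall>B\<in>\<B>. \<not> 2 \<le> card B)"
    by blast
  define \<U> where "\<U> = {\<C>. \<C> \<subseteq> \<B> \<and> cycle_on (inv_image E \<pi>) (\<Union>\<C>)}"
  have "finite \<U>" "{B0} \<in> \<U>"
    using \<open>finite \<B>\<close> B0(1) \<B>(2) unfolding \<U>_def transversal_cycle_def by auto
  then obtain \<C> where "\<C> \<in> \<U>" "{B0} \<subseteq> \<C>" and max: "\<forall>\<C>'\<in>\<U>. \<C> \<subseteq> \<C>' \<longrightarrow> \<C> = \<C>'"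
    using finite_has_maximal2[of \<U> "{B0}"] by blast
  have \<C>: "\<C> \<subseteq> \<B>" "cycle_on (inv_image E \<pi>) (\<Union>\<C>)"
    using \<open>\<C> \<in> \<U>\<close> unfolding \<U>_def by auto
  have "card B0 \<le> card (\<Union>\<C>)"
    using \<open>{B0} \<subseteq> \<C>\<close> cycle_on_finite[OF \<C>(2)] by (intro card_mono) auto
  then have large: "\<forall>B\<in>\<B>. 2 \<le> card B \<longrightarrow> 2 \<le> card (\<Union>\<C>)"
    using B0(2) by auto
  have complete: "\<not> (\<pi> ` \<Union>\<C> \<noteq> P \<or> (\<exists>B\<in>\<B> - \<C>. 2 \<le> card B))"
  proof
    assume incomplete: "\<pi> ` \<Union>\<C> \<noteq> P \<or> (\<exists>B\<in>\<B> - \<C>. 2 \<le> card B)"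
    obtain \<D> where \<D>: "\<D> \<subseteq> \<B>" "\<not> \<D> \<subseteq> \<C>" "cycle_on (inv_image E \<pi>) (\<Union>\<C> \<union> \<Union>\<D>)"
      by (rule enlarge_cycle_of_blocks[OF \<B> \<C> large incomplete])
    then have "\<C> \<union> \<D> \<in> \<U>"
      using \<C>(1) unfolding \<U>_def by (simp add: Union_Un_distrib)
    then show False
      using max \<D>(2) by blast
  qed
  show ?thesis
    by (rule that[of "\<Union>\<C>"]) (use \<C> complete in auto)
qed

lemma split_off_transversal_cycle:
  assumes "path_on (inv_image E \<pi>) S" and "\<not> inj_on \<pi> S"
  obtains B where "B \<subseteq> S" "2 \<le> card B" "transversal_cycle \<pi> B" "path_on (inv_image E \<pi>) (S - B)"
proof -
  let ?A = "inv_image E \<pi>"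
  obtain p where p: "dipath ?A p" "set p = S"
    using assms(1) unfolding path_on_def by blast
  then have "\<not> distinct (map \<pi> p)"
    using assms(2) by (auto simp: distinct_map)
  then obtain as b bs where "map \<pi> p = as @ b # bs" "b \<in> set as" "distinct as"
    unfolding not_distinct_conv_prefix by blast
  then obtain us y ws where p_split: "p = us @ y # ws" "\<pi> y \<in> \<pi> ` set us" "distinct (map \<pi> us)"
    by (auto simp: map_eq_append_conv map_eq_Cons_conv)
  then obtain us1 x us2 where us: "us = us1 @ x # us2" "\<pi> x = \<pi> y"
    by (metis imageE split_list)
  have "us2 \<noteq> []"
    using p(1) p_split(1) us irrefl by (auto simp: dipath_append_iff dipath_Cons_iff)
  then have "dicycle ?A (x # us2)" "dipath ?A (us1 @ y # ws)"
    using p(1) p_split(1) us by (auto simp: dicycle_Cons_iff dipath_append_iff dipath_Cons_iff)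
  moreover have "set (us1 @ y # ws) = S - set (x # us2)"
    using p unfolding p_split(1) us(1) dipath_def by auto
  moreover have "inj_on \<pi> (set (x # us2))"
    using p_split(3) unfolding us(1) by (auto simp: distinct_map)
  moreover have "card (set (x # us2)) = length (x # us2)"
    using p(1) unfolding p_split(1) us(1) by (intro distinct_card) (auto simp: dipath_def)
  then have "2 \<le> card (set (x # us2))"
    using \<open>us2 \<noteq> []\<close> by (cases us2) auto
  moreover have "set (x # us2) \<subseteq> S"
    using p(2) unfolding p_split(1) us(1) by auto
  ultimately show ?thesis
    using cycle_onI path_onI
    by (intro that[of "set (x # us2)"]) (force simp: transversal_cycle_def)+
qed

lemma path_on_partition:
  assumes "path_on (inv_image E \<pi>) S"
  shows "\<exists>\<B>. partition_on S \<B> \<and> (\<forall>B\<in>\<B>. transversal_cycle \<pi> B) \<and>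
    inj_on \<pi> (S - \<Union>{B \<in> \<B>. 2 \<le> card B})"
  using assms
proof (induction "card S" arbitrary: S rule: less_induct)
  case less
  show ?case
  proof (cases "inj_on \<pi> S")
    case True
    then show ?thesis
      by (intro exI[of _ "(\<lambda>x. {x}) ` S"])
        (auto simp: partition_on_singletons transversal_cycle_def cycle_on_singleton inj_on_diff)
  next
    case False
    then obtain B where B: "B \<subseteq> S" "2 \<le> card B" "transversal_cycle \<pi> B"
        and rest: "path_on (inv_image E \<pi>) (S - B)"
      using split_off_transversal_cycle[OF less.prems] by blast
    have "finite S"
      using less.prems by (auto simp: path_on_def)
    moreover have "B \<noteq> {}"
      using B(2) by auto
    ultimately have "card (S - B) < card S"
      using B(1) by (intro psubset_card_mono) auto
    then obtain \<B> where \<B>: "partition_on (S - B) \<B>" "\<forall>B\<in>\<B>. transversal_cycle \<pi> B"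
        "inj_on \<pi> ((S - B) - \<Union>{B \<in> \<B>. 2 \<le> card B})"
      using less.hyps[OF _ rest] by blast
    have "partition_on S (insert B \<B>)"
      using \<B>(1) B(1) \<open>B \<noteq> {}\<close>
      by (subst partition_on_insert) (auto simp: disjnt_def partition_on_def)
    moreover have "S - \<Union>{B' \<in> insert B \<B>. 2 \<le> card B'} = (S - B) - \<Union>{B \<in> \<B>. 2 \<le> card B}"
      using B(2) by auto
    ultimately show ?thesis
      using B(3) \<B>(2,3) by (intro exI[of _ "insert B \<B>"]) auto
  qed
qed

lemma path_partition_imp_block_partition:
  assumes "finite \<S>" and "disjoint \<S>" and paths: "\<And>S. S \<in> \<S> \<Longrightarrow> path_on (inv_image E \<pi>) S"
  obtains \<B> where "finite \<B>" "disjoint \<B>" "\<Union>\<B> = \<Union>\<S>" "\<forall>B\<in>\<B>. transversal_cycle \<pi> B"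
    "\<forall>S\<in>\<S>. inj_on \<pi> (S - \<Union>{B \<in> \<B>. 2 \<le> card B})"
proof -
  have "\<forall>S\<in>\<S>. \<exists>\<B>. partition_on S \<B> \<and> (\<forall>B\<in>\<B>. transversal_cycle \<pi> B) \<and>
      inj_on \<pi> (S - \<Union>{B \<in> \<B>. 2 \<le> card B})"
    by (intro ballI path_on_partition paths)
  from bchoice[OF this] obtain f
    where f: "\<forall>S\<in>\<S>. partition_on S (f S) \<and> (\<forall>B\<in>f S. transversal_cycle \<pi> B) \<and>
      inj_on \<pi> (S - \<Union>{B \<in> f S. 2 \<le> card B})"
    by blast
  then have part: "partition_on S (f S)" if "S \<in> \<S>" for S
    using that by simp
  define \<B> where "\<B> = (\<Union>S\<in>\<S>. f S)"
  have "finite S" if "S \<in> \<S>" for S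
    using paths[OF that] by (auto simp: path_on_def)
  then have "finite \<B>"
    using \<open>finite \<S>\<close> finite_elements[OF _ part] unfolding \<B>_def by blast
  moreover have "disjoint \<B>"
    unfolding \<B>_def
  proof (rule disjoint_UN)
    show "disjoint (f S)" if "S \<in> \<S>" for S
      using partition_onD2[OF part[OF that]] .
    show "disjoint_family_on (\<lambda>S. \<Union>(f S)) \<S>"
      using \<open>disjoint \<S>\<close> partition_onD1[OF part] by (simp add: disjoint_family_on_def disjoint_def)
  qed
  moreover have "\<Union>\<B> = \<Union>\<S>"
    unfolding \<B>_def using partition_onD1[OF part] by blast
  moreover have "\<forall>B\<in>\<B>. transversal_cycle \<pi> B"
    unfolding \<B>_def using f by blast
  moreover have "inj_on \<pi> (S - \<Union>{B \<in> \<B>. 2 \<le> card B})" if S: "S \<in> \<S>" for S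
  proof (rule inj_on_subset)
    show "inj_on \<pi> (S - \<Union>{B \<in> f S. 2 \<le> card B})"
      using f S by simp
    show "S - \<Union>{B \<in> \<B>. 2 \<le> card B} \<subseteq> S - \<Union>{B \<in> f S. 2 \<le> card B}"
      using S unfolding \<B>_def by blast
  qed
  ultimately show ?thesis
    by (intro that[of \<B>]) auto
qed

lemma inj_on_imp_path_on:
  assumes "finite M" and "inj_on \<pi> M" and "\<pi> ` M \<subseteq> P"
  shows "path_on (inv_image E \<pi>) M"
proof (rule semicomplete_path_on[OF assms(1)])
  fix x y assume xy: "x \<in> M" "y \<in> M" "x \<noteq> y"
  then have "\<pi> x \<noteq> \<pi> y"
    using assms(2) by (auto dest: inj_onD)
  then show "(x, y) \<in> inv_image E \<pi> \<or> (y, x) \<in> inv_image E \<pi>"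
    using adjacent[of "\<pi> x" "\<pi> y"] xy assms(3) by auto
qed

theorem path_partition_imp_cycle_meeting_all_parts:
  assumes "finite \<S>" and "disjoint \<S>" and paths: "\<And>S. S \<in> \<S> \<Longrightarrow> path_on (inv_image E \<pi>) S"
    and cover: "\<pi> ` \<Union>\<S> = P"
  obtains C where "C \<subseteq> \<Union>\<S>" "cycle_on (inv_image E \<pi>) C" "\<pi> ` C = P"
    "\<forall>S\<in>\<S>. path_on (inv_image E \<pi>) (S - C)"
proof -
  from assms(1-3) obtain \<B>
    where \<B>: "finite \<B>" "disjoint \<B>" "\<Union>\<B> = \<Union>\<S>" "\<forall>B\<in>\<B>. transversal_cycle \<pi> B"
      and inj: "\<forall>S\<in>\<S>. inj_on \<pi> (S - \<Union>{B \<in> \<B>. 2 \<le> card B})"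
    by (rule path_partition_imp_block_partition)
  obtain C where C: "C \<subseteq> \<Union>\<B>" "cycle_on (inv_image E \<pi>) C" "\<pi> ` C = P"
    and merged: "\<forall>B\<in>\<B>. 2 \<le> card B \<longrightarrow> B \<subseteq> C"
    by (rule merge_blocks[OF \<B>(1,2)]) (use \<B>(3,4) cover in simp_all)
  have "path_on (inv_image E \<pi>) (S - C)" if S: "S \<in> \<S>" for S
  proof (rule inj_on_imp_path_on)
    show "finite (S - C)"
      using paths[OF S] by (auto simp: path_on_def)
    have "S - C \<subseteq> S - \<Union>{B \<in> \<B>. 2 \<le> card B}"
      using merged by blast
    then show "inj_on \<pi> (S - C)"
      using inj S inj_on_subset by blast
    show "\<pi> ` (S - C) \<subseteq> P"
      using S cover by blast
  qed
  then show ?thesis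
    using C \<B>(3) by (intro that[of C]) auto
qed

end

section \<open>Ear decompositions and path covers\<close>

text \<open>The number \<open>j\<close> in \<open>ear_decomposition A W j\<close> does not count the initial cycle as an ear.\<close>

inductive ear_decomposition :: "'a rel \<Rightarrow> 'a set \<Rightarrow> nat \<Rightarrow> bool" for A where
  cycle: "cycle_on A C \<Longrightarrow> 2 \<le> card C \<Longrightarrow> ear_decomposition A C 0"
| ear: "ear_decomposition A W j \<Longrightarrow> a \<in> W \<Longrightarrow> b \<in> W \<Longrightarrow> dipath A r \<Longrightarrow> r \<noteq> [] \<Longrightarrow>
    set r \<inter> W = {} \<Longrightarrow> (a, hd r) \<in> A \<Longrightarrow> (last r, b) \<in> A \<Longrightarrow>
    ear_decomposition A (W \<union> set r) (Suc j)"

lemma ear_decomposition_finite: "ear_decomposition A W j \<Longrightarrow> finite W"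
  by (induction rule: ear_decomposition.induct) (auto dest: cycle_on_finite)

lemma ear_decomposition_mono:
  assumes "ear_decomposition A W j" and "A \<subseteq> B"
  shows "ear_decomposition B W j"
  using assms
proof (induction rule: ear_decomposition.induct)
  case (ear W j a b r)
  then show ?case
    by (intro ear_decomposition.ear[of B W j a b r]) (auto intro: dipath_mono)
qed (auto intro: ear_decomposition.cycle cycle_on_mono)

lemma ear_decomposition_strong_subdigraph:
  assumes "ear_decomposition A W j"
  shows "\<exists>B. B \<subseteq> A \<inter> W \<times> W \<and> card B = card W + j \<and> strong_on W B"
  using assms
proof (induction rule: ear_decomposition.induct)
  case (cycle C)
  then show ?case
    using cycle_on_strong_subdigraph[of A C] by (metis add_0_right)
next
  case (ear W j a b r)
  then obtain B where B: "B \<subseteq> A \<inter> W \<times> W" "card B = card W + j" "strong_on W B"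
    by blast
  let ?B = "B \<union> ear_arcs a r b"
  have "finite W"
    using ear.hyps(1) by (rule ear_decomposition_finite)
  then have "finite B"
    using B(1) by (meson finite_Int finite_SigmaI finite_subset)
  moreover have "B \<inter> ear_arcs a r b = {}"
    using B(1) ear_arcs_Int_Times[OF ear.hyps(5,6), of a b] by blast
  moreover have "distinct (a # r)"
    using ear.hyps(2,4,6) by (auto simp: dipath_def)
  ultimately have "card ?B = card (W \<union> set r) + Suc j"
    using B(2) \<open>finite W\<close> ear.hyps(6)
    by (simp add: card_Un_disjoint card_ear_arcs distinct_card Int_commute)
  moreover have "?B \<subseteq> A \<inter> (W \<union> set r) \<times> (W \<union> set r)"
    using B(1) ear_arcs_subset[OF ear.hyps(4,5,7,8)] ear_arcs_subset_Times[of a r b] ear.hyps(2,3)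
    by blast
  moreover have "strong_on (W \<union> set r) ?B"
    using strong_on_Un_ear[OF B(3) ear.hyps(2,3)] .
  ultimately show ?case
    by blast
qed

definition path_cover :: "'a rel \<Rightarrow> 'a set \<Rightarrow> 'a set set \<Rightarrow> bool" where
  "path_cover A V \<S> \<longleftrightarrow> partition_on V \<S> \<and> (\<forall>S\<in>\<S>. path_on A S)"

definition cycle_or_path_cover :: "'a rel \<Rightarrow> 'a set \<Rightarrow> nat \<Rightarrow> bool" where
  "cycle_or_path_cover A V k \<longleftrightarrow>
     (if k = 0 then cycle_on A V \<and> 2 \<le> card V else \<exists>\<S>. path_cover A V \<S> \<and> card \<S> = k)"

lemma cycle_with_ear_path_on:
  assumes "cycle_on A C" and "a \<in> C" and "dipath A r" and "set r \<inter> C = {}" and "(a, hd r) \<in> A"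
  shows "path_on A (C \<union> set r)"
proof -
  obtain xs where xs: "dicycle A (xs @ [a])" "set (xs @ [a]) = C"
    using cycle_on_lastE[OF assms(1,2)] .
  then have "dipath A ((xs @ [a]) @ r)"
    using assms(3-5) unfolding dipath_append_iff[of A "xs @ [a]"] by (auto simp: dicycle_def)
  then show ?thesis
    using path_onI xs(2) by (metis set_append)
qed

lemma path_cover_add_path:
  assumes "path_cover A W \<S>" and "finite W" and "path_on A R" and "R \<noteq> {}" and "R \<inter> W = {}"
  shows "path_cover A (W \<union> R) (insert R \<S>)" and "card (insert R \<S>) = Suc (card \<S>)"
proof -
  have \<S>: "partition_on W \<S>"
    using assms(1) by (simp add: path_cover_def)
  then have "disjnt R (\<Union>\<S>)" "W \<union> R - R = W"
    using assms(5) partition_onD1[OF \<S>] by (auto simp: disjnt_def)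
  then show "path_cover A (W \<union> R) (insert R \<S>)"
    using assms(1,3,4) by (auto simp: path_cover_def partition_on_insert)
  have "R \<notin> \<S>"
    using assms(4,5) partition_onD1[OF \<S>] by blast
  then show "card (insert R \<S>) = Suc (card \<S>)"
    using finite_elements[OF assms(2) \<S>] by simp
qed

lemma path_cover_Diff:
  assumes "path_cover A V \<S>" and "finite \<S>" and "\<forall>S\<in>\<S>. path_on A (S - C)"
  obtains \<R> where "path_cover A (V - C) \<R>" "finite \<R>" "card \<R> \<le> card \<S>"
proof -
  define \<R> where "\<R> = (\<lambda>S. S - C) ` \<S> - {{}}"
  have "partition_on V \<S>"
    using assms(1) by (simp add: path_cover_def)
  then have "partition_on (V - C) \<R>"
    unfolding \<R>_def
    by (rule partition_on_transform[where F = "\<lambda>S. S - C"]) (auto simp: disjnt_def)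
  then have "path_cover A (V - C) \<R>"
    using assms(3) by (auto simp: path_cover_def \<R>_def)
  moreover have "card \<R> \<le> card ((\<lambda>S. S - C) ` \<S>)"
    unfolding \<R>_def using \<open>finite \<S>\<close> by (intro card_mono) auto
  then have "card \<R> \<le> card \<S>"
    using card_image_le[OF \<open>finite \<S>\<close>] by (rule order_trans)
  moreover have "finite \<R>"
    using \<open>finite \<S>\<close> by (simp add: \<R>_def)
  ultimately show ?thesis
    by (intro that)
qed

text \<open>The cycle and its first ear together form a single path, hence \<open>j\<close> rather than \<open>j + 1\<close> paths.\<close>

lemma ear_decomposition_imp_cycle_or_path_cover:
  assumes "ear_decomposition A W j"
  shows "cycle_or_path_cover A W j"
  using assms
proof (induction rule: ear_decomposition.induct)
  case (cycle C)
  then show ?case by (simp add: cycle_or_path_cover_def)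
next
  case (ear W j a b r)
  have "\<exists>\<S>. path_cover A (W \<union> set r) \<S> \<and> card \<S> = Suc j"
  proof (cases "j = 0")
    case True
    then have "path_on A (W \<union> set r)"
      using ear cycle_with_ear_path_on[of A W a r] by (simp add: cycle_or_path_cover_def)
    then have "path_cover A (W \<union> set r) {W \<union> set r}"
      using ear.hyps(5) by (simp add: path_cover_def partition_on_space)
    then show ?thesis
      using True by (intro exI[of _ "{W \<union> set r}"]) simp
  next
    case False
    then obtain \<S> where \<S>: "path_cover A W \<S>" "card \<S> = j"
      using ear.IH by (auto simp: cycle_or_path_cover_def)
    show ?thesis
      using path_cover_add_path[OF \<S>(1) ear_decomposition_finite[OF ear.hyps(1)]
          path_onI[OF ear.hyps(4)]]
        ear.hyps(5,6) \<S>(2) by (intro exI[of _ "insert (set r) \<S>"]) auto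
  qed
  then show ?case
    by (simp add: cycle_or_path_cover_def)
qed

lemma ear_decomposition_cycle_and_paths:
  assumes C: "cycle_on A C" "2 \<le> card C" and "finite \<R>"
    and "disjoint \<R>" and "C \<inter> \<Union>\<R> = {}" and "\<And>R. R \<in> \<R> \<Longrightarrow> path_on A R \<and> R \<noteq> {}"
    and "\<And>x. x \<in> \<Union>\<R> \<Longrightarrow> (\<exists>a\<in>C. (a, x) \<in> A) \<and> (\<exists>b\<in>C. (x, b) \<in> A)"
  shows "ear_decomposition A (C \<union> \<Union>\<R>) (card \<R>)"
  using assms(3-)
proof (induction \<R> rule: finite_induct)
  case empty
  then show ?case
    using C by (simp add: ear_decomposition.cycle)
next
  case (insert R \<R>)
  obtain r where r: "dipath A r" "set r = R" "r \<noteq> []"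
    using insert.prems(3)[of R] by (auto simp: path_on_def)
  then have "hd r \<in> R" "last r \<in> R"
    by auto
  then obtain a b where ab: "a \<in> C" "(a, hd r) \<in> A" "b \<in> C" "(last r, b) \<in> A"
    using insert.prems(4)[of "hd r"] insert.prems(4)[of "last r"] by auto
  have "ear_decomposition A ((C \<union> \<Union>\<R>) \<union> set r) (Suc (card \<R>))"
  proof (rule ear_decomposition.ear[of A _ _ a b])
    show "ear_decomposition A (C \<union> \<Union>\<R>) (card \<R>)"
    proof (rule insert.IH)
      show "disjoint \<R>" "C \<inter> \<Union>\<R> = {}"
        using insert.prems(1,2) by (auto simp: pairwise_insert)
    qed (use insert.prems(3,4) in auto)
    have "R \<inter> S = {}" if "S \<in> \<R>" for S
      using insert.prems(1) insert.hyps(2) that by (auto dest: disjointD)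
    then show "set r \<inter> (C \<union> \<Union>\<R>) = {}"
      using insert.prems(2) r(2) by blast
  qed (use r ab in auto)
  moreover have "(C \<union> \<Union>\<R>) \<union> set r = C \<union> \<Union>(insert R \<R>)"
    using r(2) by auto
  ultimately show ?case
    using insert.hyps by simp
qed

lemma dipath_into:
  assumes "(v, w) \<in> A\<^sup>*" and "v \<notin> W" and "w \<in> W"
  obtains r b where "r \<noteq> []" "hd r = v" "dipath A r" "set r \<inter> W = {}" "set r \<subseteq> Domain A"
    "b \<in> W" "(last r, b) \<in> A"
  using assms
proof (induction arbitrary: thesis rule: converse_rtrancl_induct)
  case (step v v')
  show ?case
  proof (cases "v' \<in> W")
    case True
    then show ?thesis
      using step.hyps(1) step.prems by (intro step.prems(1)[of "[v]" v']) auto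
  next
    case False
    then obtain r b where r: "r \<noteq> []" "hd r = v'" "dipath A r" "set r \<inter> W = {}" "set r \<subseteq> Domain A"
      and b: "b \<in> W" "(last r, b) \<in> A"
      using step.IH step.prems(3) by blast
    show ?thesis
    proof (cases "v \<in> set r")
      case True
      then obtain xs ys where "r = xs @ v # ys" by (meson split_list)
      then show ?thesis
        using r b by (intro step.prems(1)[of "v # ys" b]) (auto simp: dipath_append_iff)
    next
      case False
      then show ?thesis
        using r b step.hyps(1) step.prems(2)
        by (intro step.prems(1)[of "v # r" b]) (auto simp: dipath_Cons_iff)
    qed
  qed
qed simp

lemma strong_on_ex_ear:
  assumes strong: "strong_on V A" and A: "A \<subseteq> V \<times> V" and W: "W \<subseteq> V" "W \<noteq> {}" "W \<noteq> V"
  obtains a r b where "a \<in> W" "b \<in> W" "dipath A r" "r \<noteq> []" "set r \<inter> W = {}"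
    "(a, hd r) \<in> A" "(last r, b) \<in> A" "set r \<subseteq> V"
proof -
  obtain a y where ay: "a \<in> W" "y \<in> V - W" "(a, y) \<in> A"
    using strong_on_leaving_arc[OF strong A W] .
  then have "(y, a) \<in> A\<^sup>*" "y \<notin> W"
    using strong_onD[OF strong] W(1) by auto
  then obtain r b where r: "r \<noteq> []" "hd r = y" "dipath A r" "set r \<inter> W = {}" "set r \<subseteq> Domain A"
    "b \<in> W" "(last r, b) \<in> A"
    using dipath_into[of y a A W] ay(1) by blast
  moreover have "Domain A \<subseteq> V"
    using A by blast
  ultimately show ?thesis
    using that[of a b r] ay by auto
qed

lemma ear_decomposition_extend:
  assumes strong: "strong_on V A" and A: "A \<subseteq> V \<times> V" and V: "finite V"
    and "ear_decomposition A W j" and "W \<subseteq> V" and "W \<noteq> {}"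
  shows "\<exists>j. ear_decomposition A V j"
  using assms(4-)
proof (induction "card (V - W)" arbitrary: W j rule: less_induct)
  case less
  show ?case
  proof (cases "W = V")
    case True
    then show ?thesis using less.prems by auto
  next
    case False
    obtain a r b where ear: "a \<in> W" "b \<in> W" "dipath A r" "r \<noteq> []" "set r \<inter> W = {}"
        "(a, hd r) \<in> A" "(last r, b) \<in> A" and "set r \<subseteq> V"
      by (rule strong_on_ex_ear[OF strong A less.prems(2,3) False])
    have "hd r \<in> V - W" "hd r \<in> set r"
      using \<open>set r \<subseteq> V\<close> ear(4,5) by (auto dest: hd_in_set)
    then have "card (V - (W \<union> set r)) < card (V - W)"
      using V by (intro psubset_card_mono) auto
    moreover have "ear_decomposition A (W \<union> set r) (Suc j)"
      using less.prems(1) ear by (rule ear_decomposition.ear)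
    ultimately show ?thesis
      using less.hyps[of "W \<union> set r" "Suc j"] less.prems(2) \<open>set r \<subseteq> V\<close> ear(4) by simp
  qed
qed

theorem strong_on_imp_ear_decomposition:
  assumes strong: "strong_on V A" and A: "A \<subseteq> V \<times> V" and card: "2 \<le> card V"
  shows "\<exists>j. ear_decomposition A V j"
proof -
  have V: "finite V" "V \<noteq> {}"
    using card by (auto intro: card_ge_0_finite)
  then obtain x where x: "x \<in> V" by blast
  then have "{x} \<subseteq> V" "{x} \<noteq> {}" "{x} \<noteq> V"
    using card by auto
  then obtain a r b where r: "a \<in> {x}" "b \<in> {x}" "dipath A r" "r \<noteq> []" "set r \<inter> {x} = {}"
      "(a, hd r) \<in> A" "(last r, b) \<in> A" "set r \<subseteq> V"
    by (rule strong_on_ex_ear[OF strong A])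
  then have "dicycle A (x # r)"
    by (auto simp: dicycle_Cons_iff dipath_Cons_iff)
  then have "cycle_on A (set (x # r))"
    by (rule cycle_onI)
  moreover have "card (set (x # r)) = Suc (card (set r))" "card (set r) \<noteq> 0"
    using r(4,5) by simp_all
  then have "2 \<le> card (set (x # r))"
    by linarith
  ultimately have "ear_decomposition A (set (x # r)) 0"
    by (rule ear_decomposition.cycle)
  then show ?thesis
    using ear_decomposition_extend[OF strong A V(1)] x r(8) by auto
qed

section \<open>Semicomplete compositions\<close>

fun runs :: "('a \<Rightarrow> 'b) \<Rightarrow> 'a list \<Rightarrow> 'a list list" where
  "runs \<rho> [] = []"
| "runs \<rho> (x # xs) =
     (case runs \<rho> xs of
        [] \<Rightarrow> [[x]]
      | s # ss \<Rightarrow> if \<rho> x = \<rho> (hd s) then (x # s) # ss else [x] # s # ss)"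

lemma concat_runs [simp]: "concat (runs \<rho> xs) = xs"
  by (induction xs) (auto split: list.split)

lemma Nil_notin_runs [simp]: "[] \<notin> set (runs \<rho> xs)"
  by (induction xs) (auto split: list.split)

lemma image_run: "s \<in> set (runs \<rho> xs) \<Longrightarrow> \<rho> ` set s = {\<rho> (hd s)}"
proof (induction xs arbitrary: s)
  case (Cons x xs)
  show ?case
  proof (cases "runs \<rho> xs")
    case (Cons t ss)
    then consider "s = x # t" "\<rho> x = \<rho> (hd t)" | "s = [x]" | "s \<in> set (runs \<rho> xs)"
      using Cons.prems by (auto split: if_splits)
    then show ?thesis
    proof cases
      case 1
      moreover have "\<rho> ` set t = {\<rho> (hd t)}"
        by (rule Cons.IH) (simp add: Cons)
      ultimately show ?thesis by simp
    qed (simp, rule Cons.IH)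
  qed (use Cons.prems in simp)
qed simp

lemma successively_runs: "successively (\<lambda>s t. \<rho> (hd s) \<noteq> \<rho> (hd t)) (runs \<rho> xs)"
  by (induction xs) (auto simp: successively_Cons split: list.split)

lemma Union_set_runs: "\<Union>(set ` set (runs \<rho> xs)) = set xs"
  by (metis concat_runs set_concat)

lemma disjoint_set_runs:
  assumes "disjoint \<S>" and p: "\<And>S. S \<in> \<S> \<Longrightarrow> set (p S) = S"
  shows "disjoint ((\<lambda>S. set (runs \<rho> (p S))) ` \<S>)"
proof (rule disjointI)
  fix K L assume "K \<in> (\<lambda>S. set (runs \<rho> (p S))) ` \<S>" "L \<in> (\<lambda>S. set (runs \<rho> (p S))) ` \<S>" "K \<noteq> L"
  then obtain S S' where S: "S \<in> \<S>" "S' \<in> \<S>" "K = set (runs \<rho> (p S))" "L = set (runs \<rho> (p S'))"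
    "S \<inter> S' = {}"
    using disjointD[OF assms(1)] by blast
  have False if "s \<in> K" "s \<in> L" for s
  proof -
    have "s \<noteq> []"
      using that(1) S(3) Nil_notin_runs by metis
    moreover have "set s \<subseteq> S" "set s \<subseteq> S'"
      using that S(3,4) Union_set_runs p[OF S(1)] p[OF S(2)] by (metis UN_upper)+
    ultimately show False
      using S(5) by (metis Int_greatest set_empty subset_empty)
  qed
  then show "K \<inter> L = {}"
    by blast
qed

locale semicomplete_composition = strong_semicomplete E P
  for E :: "'b rel" and P :: "'b set" +
  fixes \<rho> :: "'a \<Rightarrow> 'b" and A :: "'a rel" and V :: "'a set"
  assumes image_V: "\<rho> ` V = P"
    and arc_between_parts: "(x, y) \<in> A \<Longrightarrow> \<rho> x \<noteq> \<rho> y \<Longrightarrow> (\<rho> x, \<rho> y) \<in> E"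
    and arc_if_parts_adjacent: "x \<in> V \<Longrightarrow> y \<in> V \<Longrightarrow> (\<rho> x, \<rho> y) \<in> E \<Longrightarrow> (x, y) \<in> A"
begin

text \<open>The paths of a path cover, cut into runs within the parts, are paths in this blow-up of \<open>E\<close>,
  whose vertices are lists.\<close>

abbreviation run_arcs :: "'a list rel" where
  "run_arcs \<equiv> inv_image E (\<lambda>s. \<rho> (hd s))"

definition disjoint_runs :: "'a list set \<Rightarrow> bool" where
  "disjoint_runs M \<longleftrightarrow> (\<forall>s\<in>M. s \<noteq> [] \<and> dipath A s \<and> set s \<subseteq> V \<and> \<rho> ` set s = {\<rho> (hd s)}) \<and>
     disjoint_family_on set M"

lemma disjoint_runsD:
  assumes "disjoint_runs M" and "s \<in> M"
  shows "s \<noteq> []" "dipath A s" "set s \<subseteq> V" "\<rho> ` set s = {\<rho> (hd s)}"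
  using assms by (auto simp: disjoint_runs_def)

lemma disjoint_runs_disjoint:
  "disjoint_runs M \<Longrightarrow> s \<in> M \<Longrightarrow> t \<in> M \<Longrightarrow> s \<noteq> t \<Longrightarrow> set s \<inter> set t = {}"
  by (auto simp: disjoint_runs_def disjoint_family_on_def)

lemma run_arcs_imp_arc:
  assumes M: "disjoint_runs M" and "s \<in> M" "t \<in> M" and "(s, t) \<in> run_arcs"
  shows "(last s, hd t) \<in> A"
proof (rule arc_if_parts_adjacent)
  have "last s \<in> set s" "hd t \<in> set t"
    using disjoint_runsD(1)[OF M] assms(2,3) by auto
  moreover from this have "\<rho> (last s) = \<rho> (hd s)"
    using disjoint_runsD(4)[OF M assms(2)] by blast
  ultimately show "last s \<in> V" "hd t \<in> V" "(\<rho> (last s), \<rho> (hd t)) \<in> E"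
    using disjoint_runsD(3)[OF M] assms(2-4) by auto
qed

lemma dipath_runs:
  assumes "dipath A p"
  shows "dipath run_arcs (runs \<rho> p)"
proof -
  have p: "distinct (concat (runs \<rho> p))" "\<forall>s\<in>set (runs \<rho> p). dipath A s"
    and arcs: "successively (\<lambda>s t. (last s, hd t) \<in> A) (runs \<rho> p)"
    using assms dipath_concat_iff[OF Nil_notin_runs, of A \<rho> p] by auto
  have "successively (\<lambda>s t. (s, t) \<in> run_arcs) (runs \<rho> p)"
    unfolding successively_conv_nth
  proof (intro allI impI)
    fix i assume i: "Suc i < length (runs \<rho> p)"
    let ?s = "runs \<rho> p ! i" and ?t = "runs \<rho> p ! Suc i"
    have s: "?s \<in> set (runs \<rho> p)"
      using i by simp
    then have "?s \<noteq> []"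
      using Nil_notin_runs by metis
    then have "\<rho> (last ?s) = \<rho> (hd ?s)"
      using image_run[OF s] last_in_set by blast
    moreover have "(last ?s, hd ?t) \<in> A" "\<rho> (hd ?s) \<noteq> \<rho> (hd ?t)"
      using successively_nth[OF arcs i] successively_nth[OF successively_runs i] by simp_all
    ultimately show "(?s, ?t) \<in> run_arcs"
      using arc_between_parts[of "last ?s" "hd ?t"] by simp
  qed
  moreover have "distinct (runs \<rho> p)"
    using p(1) unfolding distinct_concat_iff removeAll_id[OF Nil_notin_runs] by blast
  ultimately show ?thesis
    by (simp add: dipath_def)
qed

lemma dipath_concat_runs:
  assumes "disjoint_runs M" and "dipath run_arcs ss" and "set ss \<subseteq> M"
  shows "dipath A (concat ss)"
proof -
  have ss: "s \<noteq> []" "dipath A s" if "s \<in> set ss" for s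
    using disjoint_runsD(1,2)[OF assms(1)] assms(3) that by auto
  then have "[] \<notin> set ss"
    by blast
  moreover have "distinct (concat ss)"
  proof (rule distinct_concat)
    show "set s \<inter> set t = {}" if "s \<in> set ss" "t \<in> set ss" "s \<noteq> t" for s t
      using that assms(3) by (intro disjoint_runs_disjoint[OF assms(1)]) auto
    show "distinct ss"
      using assms(2) by (simp add: dipath_def)
    show "distinct s" if "s \<in> set ss" for s
      using ss(2)[OF that] by (simp add: dipath_def)
  qed
  moreover have "successively (\<lambda>s t. (last s, hd t) \<in> A) ss"
  proof (rule successively_mono)
    show "successively (\<lambda>s t. (s, t) \<in> run_arcs) ss"
      using assms(2) by (simp add: dipath_def)
    show "(last s, hd t) \<in> A" if "s \<in> set ss" "t \<in> set ss" "(s, t) \<in> run_arcs" for s t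
      using that assms(3) by (intro run_arcs_imp_arc[OF assms(1)]) auto
  qed
  ultimately show ?thesis
    using ss(2) by (simp add: dipath_concat_iff)
qed

lemma path_on_Union_runs:
  assumes "disjoint_runs M" and "path_on run_arcs N" and "N \<subseteq> M"
  shows "path_on A (\<Union>(set ` N))"
proof -
  obtain ss where ss: "dipath run_arcs ss" "set ss = N"
    using assms(2) unfolding path_on_def by blast
  then have "dipath A (concat ss)"
    using dipath_concat_runs[OF assms(1)] assms(3) by simp
  then show ?thesis
    using path_onI[of A "concat ss"] ss(2) by simp
qed

lemma cycle_on_Union_runs:
  assumes M: "disjoint_runs M" and "cycle_on run_arcs N" and "N \<subseteq> M" and "2 \<le> card N"
  shows "cycle_on A (\<Union>(set ` N))"
proof -
  obtain ss where ss: "dicycle run_arcs ss" "set ss = N"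
    using assms(2) unfolding cycle_on_def by blast
  have "2 \<le> length ss"
    using assms(4) ss(2) card_length[of ss] by simp
  then have "ss \<noteq> []" and arc: "(last ss, hd ss) \<in> run_arcs"
    using ss(1) by (auto simp: dicycle_def)
  then have "(last (last ss), hd (hd ss)) \<in> A"
    using ss(2) assms(3) by (intro run_arcs_imp_arc[OF M]) auto
  moreover have "[] \<notin> set ss"
    using disjoint_runsD(1)[OF M] ss(2) assms(3) by blast
  moreover have "dipath A (concat ss)"
    using ss assms(3) by (intro dipath_concat_runs[OF M]) (auto simp: dicycle_def)
  ultimately have "dicycle A (concat ss)"
    using \<open>ss \<noteq> []\<close> by (intro dicycle_concat)
  then show ?thesis
    using cycle_onI[of A "concat ss"] ss(2) by simp
qed

lemma image_Union_runs:
  assumes "disjoint_runs M" and "N \<subseteq> M"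
  shows "\<rho> ` \<Union>(set ` N) = (\<lambda>s. \<rho> (hd s)) ` N"
proof -
  have "\<rho> ` set s = {\<rho> (hd s)}" if "s \<in> N" for s
    using disjoint_runsD(4)[OF assms(1)] assms(2) that by blast
  then have "(\<Union>s\<in>N. \<rho> ` set s) = (\<Union>s\<in>N. {\<rho> (hd s)})"
    by (rule SUP_cong[OF refl])
  then show ?thesis
    by (simp add: image_UN UNION_singleton_eq_range)
qed

lemma Union_runs_Diff:
  assumes M: "disjoint_runs M" and "L \<subseteq> M" "N \<subseteq> M"
  shows "\<Union>(set ` (L - N)) = \<Union>(set ` L) - \<Union>(set ` N)"
proof -
  have "set s \<inter> set t = {}" if "s \<in> L - N" "t \<in> N" for s t
    using that assms(2,3) by (intro disjoint_runs_disjoint[OF M]) auto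
  then have "\<Union>(set ` (L - N)) \<inter> \<Union>(set ` N) = {}"
    by (simp add: Int_UN_distrib2)
  moreover have "\<Union>(set ` L) \<subseteq> \<Union>(set ` (L - N)) \<union> \<Union>(set ` N)"
    by auto
  moreover have "\<Union>(set ` (L - N)) \<subseteq> \<Union>(set ` L)"
    by auto
  ultimately show ?thesis
    by blast
qed

lemma run_paths_imp_cycle_meeting_all_parts:
  assumes "finite \<L>" and "disjoint \<L>" and M: "disjoint_runs (\<Union>\<L>)"
    and paths: "\<And>L. L \<in> \<L> \<Longrightarrow> path_on run_arcs L" and cover: "\<Union>(set ` \<Union>\<L>) = V"
  obtains C where "C \<subseteq> V" "cycle_on A C" "\<rho> ` C = P"
    "\<forall>L\<in>\<L>. path_on A (\<Union>(set ` L) - C)"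
proof -
  have "(\<lambda>s. \<rho> (hd s)) ` \<Union>\<L> = P"
    using image_Union_runs[OF M subset_refl] image_V unfolding cover by simp
  from assms(1,2) paths this obtain N
    where N: "N \<subseteq> \<Union>\<L>" "cycle_on run_arcs N" "(\<lambda>s. \<rho> (hd s)) ` N = P"
    and rest: "\<forall>L\<in>\<L>. path_on run_arcs (L - N)"
    by (rule path_partition_imp_cycle_meeting_all_parts)
  define C where "C = \<Union>(set ` N)"
  have "C \<subseteq> V"
    using N(1) cover unfolding C_def by blast
  moreover have "card P \<le> card N"
    using N(3) card_image_le[OF cycle_on_finite[OF N(2)]] by metis
  then have "cycle_on A C"
    unfolding C_def using card_P by (intro cycle_on_Union_runs[OF M N(2,1)]) simp
  moreover have "\<rho> ` C = P"
    unfolding C_def image_Union_runs[OF M N(1)] by (rule N(3))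
  moreover have "\<forall>L\<in>\<L>. path_on A (\<Union>(set ` L) - C)"
  proof
    fix L assume "L \<in> \<L>"
    then have "L \<subseteq> \<Union>\<L>"
      by blast
    then have "path_on A (\<Union>(set ` (L - N)))"
      using rest \<open>L \<in> \<L>\<close> by (intro path_on_Union_runs[OF M]) auto
    then show "path_on A (\<Union>(set ` L) - C)"
      unfolding C_def Union_runs_Diff[OF M \<open>L \<subseteq> \<Union>\<L>\<close> N(1)] .
  qed
  ultimately show ?thesis
    by (rule that)
qed

lemma disjoint_runs_of_paths:
  assumes "disjoint \<S>" and p: "\<And>S. S \<in> \<S> \<Longrightarrow> dipath A (p S) \<and> set (p S) = S" and "\<Union>\<S> \<subseteq> V"
  shows "disjoint_runs (\<Union>S\<in>\<S>. set (runs \<rho> (p S)))"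
proof -
  have run: "set s \<subseteq> S" "s \<noteq> []" "dipath A s"
    if "S \<in> \<S>" "s \<in> set (runs \<rho> (p S))" for S s
  proof -
    have "dipath A (concat (runs \<rho> (p S)))" "set (concat (runs \<rho> (p S))) = S"
      using p[OF that(1)] by simp_all
    then show "dipath A s" "set s \<subseteq> S"
      using that(2) unfolding dipath_concat_iff[OF Nil_notin_runs] set_concat by blast+
    show "s \<noteq> []"
      using that(2) Nil_notin_runs by metis
  qed
  have disj: "set s \<inter> set t = {}"
    if "S \<in> \<S>" "S' \<in> \<S>" "s \<in> set (runs \<rho> (p S))" "t \<in> set (runs \<rho> (p S'))" "s \<noteq> t" for S S' s t
  proof (cases "S = S'")
    case True
    have "distinct (concat (runs \<rho> (p S)))"
      using p[OF that(1)] by (simp add: dipath_def)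
    then show ?thesis
      using that(3-5) True unfolding distinct_concat_iff by blast
  next
    case False
    then have "S \<inter> S' = {}"
      using disjointD[OF assms(1) that(1,2)] by simp
    then show ?thesis
      using run(1)[OF that(1,3)] run(1)[OF that(2,4)] by blast
  qed
  show ?thesis
    unfolding disjoint_runs_def disjoint_family_on_def
  proof (intro conjI ballI impI)
    fix s assume "s \<in> (\<Union>S\<in>\<S>. set (runs \<rho> (p S)))"
    then obtain S where S: "S \<in> \<S>" "s \<in> set (runs \<rho> (p S))"
      by blast
    then show "s \<noteq> []" "dipath A s" "set s \<subseteq> V" "\<rho> ` set s = {\<rho> (hd s)}"
      using run[OF S] assms(3) image_run by blast+
  qed (use disj in blast)
qed

theorem path_cover_imp_cycle_meeting_all_parts:
  assumes "path_cover A V \<S>" and "finite \<S>"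
  obtains C where "C \<subseteq> V" "cycle_on A C" "\<rho> ` C = P" "\<forall>S\<in>\<S>. path_on A (S - C)"
proof -
  have V: "V = \<Union>\<S>" and "disjoint \<S>"
    using assms(1) partition_onD1 partition_onD2 by (auto simp: path_cover_def)
  obtain p where p: "\<And>S. S \<in> \<S> \<Longrightarrow> dipath A (p S) \<and> set (p S) = S"
    using assms(1) unfolding path_cover_def path_on_def by metis
  define R where "R S = set (runs \<rho> (p S))" for S
  have Union_R: "\<Union>(set ` R S) = S" if "S \<in> \<S>" for S
    using p[OF that] by (simp add: R_def Union_set_runs)
  have "finite (R ` \<S>)"
    using \<open>finite \<S>\<close> by simp
  moreover have "disjoint (R ` \<S>)"
    unfolding R_def using p by (intro disjoint_set_runs[OF \<open>disjoint \<S>\<close>]) simp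
  moreover have "disjoint_runs (\<Union>(R ` \<S>))"
    unfolding R_def using V by (intro disjoint_runs_of_paths[OF \<open>disjoint \<S>\<close> p]) auto
  moreover have "path_on run_arcs L" if "L \<in> R ` \<S>" for L
    using that p by (auto simp: R_def intro!: path_onI dipath_runs)
  moreover have "\<Union>(set ` \<Union>(R ` \<S>)) = V"
    unfolding V using Union_R by auto
  ultimately obtain C where C: "C \<subseteq> V" "cycle_on A C" "\<rho> ` C = P"
      "\<forall>L\<in>R ` \<S>. path_on A (\<Union>(set ` L) - C)"
    by (rule run_paths_imp_cycle_meeting_all_parts)
  have "\<forall>S\<in>\<S>. path_on A (S - C)"
    using C(4) Union_R by simp
  with C(1-3) show ?thesis
    by (rule that)
qed

lemma in_arc_from_set_meeting_all_parts:
  assumes "C \<subseteq> V" and "\<rho> ` C = P" and "x \<in> V"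
  obtains a where "a \<in> C" "(a, x) \<in> A"
proof -
  have "\<rho> x \<in> P"
    using assms(3) image_V by blast
  then obtain u where "u \<in> \<rho> ` C" "(u, \<rho> x) \<in> E"
    using ex_in_arc assms(2) by metis
  then show ?thesis
    using that arc_if_parts_adjacent assms(1,3) by blast
qed

lemma out_arc_to_set_meeting_all_parts:
  assumes "C \<subseteq> V" and "\<rho> ` C = P" and "x \<in> V"
  obtains b where "b \<in> C" "(x, b) \<in> A"
proof -
  have "\<rho> x \<in> P"
    using assms(3) image_V by blast
  then obtain u where "u \<in> \<rho> ` C" "(\<rho> x, u) \<in> E"
    using ex_out_arc assms(2) by metis
  then show ?thesis
    using that arc_if_parts_adjacent assms(1,3) by blast
qed

theorem cycle_or_path_cover_imp_ear_decomposition: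
  assumes "cycle_or_path_cover A V k"
  shows "\<exists>j\<le>k. ear_decomposition A V j"
proof (cases "k = 0")
  case True
  then show ?thesis
    using assms by (auto simp: cycle_or_path_cover_def intro: ear_decomposition.cycle)
next
  case False
  then obtain \<S> where \<S>: "path_cover A V \<S>" "card \<S> = k"
    using assms by (auto simp: cycle_or_path_cover_def)
  then have "finite \<S>"
    using False card_ge_0_finite by auto
  obtain C where C: "C \<subseteq> V" "cycle_on A C" "\<rho> ` C = P" and "\<forall>S\<in>\<S>. path_on A (S - C)"
    by (rule path_cover_imp_cycle_meeting_all_parts[OF \<S>(1) \<open>finite \<S>\<close>])
  then obtain \<R> where \<R>: "path_cover A (V - C) \<R>" "finite \<R>" "card \<R> \<le> k"
    using path_cover_Diff[OF \<S>(1) \<open>finite \<S>\<close>] \<S>(2) by metis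
  have "card P \<le> card C"
    using C(3) card_image_le[OF cycle_on_finite[OF C(2)]] by metis
  then have "2 \<le> card C"
    using card_P by simp
  moreover have rest: "\<Union>\<R> = V - C" "disjoint \<R>" "\<forall>R\<in>\<R>. path_on A R \<and> R \<noteq> {}"
    using \<R>(1) by (auto simp: path_cover_def partition_on_def)
  moreover have "(\<exists>a\<in>C. (a, x) \<in> A) \<and> (\<exists>b\<in>C. (x, b) \<in> A)" if "x \<in> V" for x
    using in_arc_from_set_meeting_all_parts[OF C(1,3) that]
      out_arc_to_set_meeting_all_parts[OF C(1,3) that]
    by metis
  ultimately have "ear_decomposition A (C \<union> \<Union>\<R>) (card \<R>)"
    using \<R>(2) by (intro ear_decomposition_cycle_and_paths[OF C(2)]) auto
  moreover have "C \<union> \<Union>\<R> = V"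
    using rest(1) C(1) by blast
  ultimately show ?thesis
    using \<R>(3) by auto
qed

end

section \<open>Hamiltonicity of the extended digraphs\<close>

lemma pcas_zip: "pcas a (zip (a # r) (r @ [b])) b"
  by (induction r arbitrary: a) auto

lemma pawalk_verts_zip: "pawalk_verts u (zip (a # r) (r @ [b])) = a # r @ [b]"
  by (induction r arbitrary: a u) auto

lemma pcas_heads:
  assumes "pcas u p v" and "set p \<subseteq> A" and "p \<noteq> []"
  shows "successively (\<lambda>x y. (x, y) \<in> A) (map snd p) \<and> last (map snd p) = v \<and>
    (u, hd (map snd p)) \<in> A \<and> pawalk_verts w p = u # map snd p"
  using assms
proof (induction p arbitrary: u w)
  case (Cons e p)
  show ?case
  proof (cases "p = []")
    case True
    then show ?thesis using Cons.prems by (cases e) auto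
  next
    case False
    then show ?thesis
      using Cons.IH[of "snd e" "snd e"] Cons.prems by (cases e) (auto simp: successively_Cons)
  qed
qed simp

lemma hamiltonian_imp_cycle_on:
  assumes "pair_loopfree_digraph G" and "hamiltonian (with_proj G)"
  shows "cycle_on (parcs G) (pverts G)" and "2 \<le> card (pverts G)"
proof -
  interpret pair_loopfree_digraph G by (rule assms(1))
  obtain w u p where p: "pcas u p u" "set p \<subseteq> parcs G" "p \<noteq> []"
    "distinct (tl (pawalk_verts u p))" "set (pawalk_verts w p) = pverts G"
    using assms(2) unfolding hamiltonian_def pre_digraph.cycle_def pre_digraph.awalk_def
    by (auto simp: cas_with_proj_eq awalk_verts_with_proj_eq)
  define c where "c = map snd p"
  have c: "successively (\<lambda>x y. (x, y) \<in> parcs G) c" "last c = u" "(u, hd c) \<in> parcs G"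
    "pawalk_verts u p = u # c" "pawalk_verts w p = u # c"
    using pcas_heads[OF p(1-3)] unfolding c_def by blast+
  have "c \<noteq> []" "distinct c"
    using p(3,4) c(4) by (simp_all add: c_def)
  then have "u \<in> set c"
    using c(2) last_in_set by blast
  then have set_c: "set c = pverts G"
    using p(5) c(5) by auto
  have "dicycle (parcs G) c"
    using c(1-3) \<open>c \<noteq> []\<close> \<open>distinct c\<close> by (simp add: dicycle_def dipath_def)
  then show "cycle_on (parcs G) (pverts G)"
    using cycle_onI set_c by metis
  have "hd c \<in> set c" "hd c \<noteq> u"
    using \<open>c \<noteq> []\<close> pair_no_loops[OF c(3)] by auto
  then have "card {hd c, u} \<le> card (pverts G)"
    using \<open>u \<in> set c\<close> unfolding set_c[symmetric] by (intro card_mono) auto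
  then show "2 \<le> card (pverts G)"
    using \<open>hd c \<noteq> u\<close> by simp
qed

lemma cycle_on_imp_hamiltonian:
  assumes "cycle_on (parcs G) (pverts G)" and "2 \<le> card (pverts G)"
  shows "hamiltonian (with_proj G)"
proof -
  obtain x where "x \<in> pverts G"
    using cycle_on_nonempty[OF assms(1)] by blast
  then obtain xs where xs: "dicycle (parcs G) (x # xs)" "set (x # xs) = pverts G"
    using cycle_on_hdE[OF assms(1)] by metis
  then have "xs \<noteq> []"
    using assms(2) by (cases xs) (auto simp flip: xs(2))
  then have "ear_arcs x xs x \<subseteq> parcs G"
    using xs(1) by (intro ear_arcs_subset) (auto simp: dicycle_Cons_iff dipath_Cons_iff)
  let ?p = "zip (x # xs) (xs @ [x])"
  have "set ?p \<subseteq> parcs G"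
    using \<open>ear_arcs x xs x \<subseteq> parcs G\<close> by (simp add: ear_arcs_def)
  moreover have "distinct (xs @ [x])"
    using xs(1) by (simp add: dicycle_def dipath_def)
  moreover have "x \<in> pverts G" "set (x # xs @ [x]) = pverts G"
    using xs(2) by auto
  ultimately have "pre_digraph.cycle (with_proj G) ?p \<and>
    set (pre_digraph.awalk_verts (with_proj G) x ?p) = verts (with_proj G)"
    unfolding pre_digraph.cycle_def pre_digraph.awalk_def cas_with_proj_eq awalk_verts_with_proj_eq
      pawalk_verts_zip with_proj_simps
    by (intro conjI exI[of _ x] pcas_zip) (auto simp: \<open>xs \<noteq> []\<close>)
  then show ?thesis
    unfolding hamiltonian_def by blast
qed

lemma H_ext_arcs [simp]:
  "(Old u, Old v) \<in> parcs (H_ext k D) \<longleftrightarrow> (u, v) \<in> parcs D"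
  "(Old u, X i) \<in> parcs (H_ext k D) \<longleftrightarrow> u \<in> pverts D \<and> i \<in> {1..k}"
  "(Y i, Old v) \<in> parcs (H_ext k D) \<longleftrightarrow> v \<in> pverts D \<and> i \<in> {1..k}"
  "(X i, Y j) \<in> parcs (H_ext k D) \<longleftrightarrow> i \<in> {1..k} \<and> j \<in> {1..k}"
  "(Old u, Y i) \<notin> parcs (H_ext k D)" "(X i, Old u) \<notin> parcs (H_ext k D)"
  "(X i, X j) \<notin> parcs (H_ext k D)" "(Y i, Y j) \<notin> parcs (H_ext k D)"
  "(Y i, X j) \<notin> parcs (H_ext k D)"
  by (auto simp: H_ext_def)

lemma H_ext_verts: "pverts (H_ext k D) = Old ` pverts D \<union> X ` {1..k} \<union> Y ` {1..k}"
  by (simp add: H_ext_def)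

lemma loopfree_H_ext:
  assumes "pair_loopfree_digraph D"
  shows "pair_loopfree_digraph (H_ext k D)"
proof -
  interpret pair_loopfree_digraph D by (rule assms)
  show ?thesis
  proof
    show "fst e \<in> pverts (H_ext k D)" if "e \<in> parcs (H_ext k D)" for e
      using that arc_fst_in_verts unfolding H_ext_def by force
    show "snd e \<in> pverts (H_ext k D)" if "e \<in> parcs (H_ext k D)" for e
      using that arc_snd_in_verts unfolding H_ext_def by force
    show "fst e \<noteq> snd e" if "e \<in> parcs (H_ext k D)" for e
      using that pair_no_loops unfolding H_ext_def by force
  qed
qed

lemma dipath_map_Old [simp]: "dipath (parcs (H_ext k D)) (map Old p) \<longleftrightarrow> dipath (parcs D) p"
  by (auto simp: dipath_def successively_map distinct_map inj_on_def)

lemma cycle_on_Old_image: "cycle_on (parcs (H_ext k D)) (Old ` C) \<longleftrightarrow> cycle_on (parcs D) C"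
proof
  have dicycle: "dicycle (parcs (H_ext k D)) (map Old c) \<longleftrightarrow> dicycle (parcs D) c" for c
    by (cases "c = []") (auto simp: dicycle_def hd_map last_map)
  show "cycle_on (parcs D) C" if cyc: "cycle_on (parcs (H_ext k D)) (Old ` C)"
  proof -
    obtain d where d: "dicycle (parcs (H_ext k D)) d" "set d = Old ` C"
      using cyc unfolding cycle_on_def by blast
    then obtain c where "d = map Old c"
      by (metis ex_map_conv imageE)
    then have "dicycle (parcs D) c" "set c = C"
      using d dicycle by auto
    then show ?thesis
      using cycle_onI by metis
  qed
  show "cycle_on (parcs (H_ext k D)) (Old ` C)" if cyc: "cycle_on (parcs D) C"
  proof -
    obtain c where "dicycle (parcs D) c" "set c = C"
      using cyc unfolding cycle_on_def by blast
    then show ?thesis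
      using cycle_onI[of "parcs (H_ext k D)" "map Old c"] dicycle by simp
  qed
qed

definition join_paths :: "('a list \<times> nat \<times> nat) list \<Rightarrow> 'a ext_vertex list" where
  "join_paths ts = concat (map (\<lambda>(p, i, j). map Old p @ [X i, Y j]) ts)"

lemma join_paths_Nil [simp]: "join_paths [] = []"
  by (simp add: join_paths_def)

lemma join_paths_Cons [simp]:
  "join_paths ((p, i, j) # ts) = map Old p @ X i # Y j # join_paths ts"
  by (simp add: join_paths_def)

lemma in_set_join_paths:
  "Old v \<in> set (join_paths ts) \<longleftrightarrow> v \<in> set (concat (map fst ts))"
  "X i \<in> set (join_paths ts) \<longleftrightarrow> i \<in> set (map (fst \<circ> snd) ts)"
  "Y j \<in> set (join_paths ts) \<longleftrightarrow> j \<in> set (map (snd \<circ> snd) ts)"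
  by (induction ts) auto

lemma distinct_join_paths:
  "distinct (join_paths ts) \<longleftrightarrow> distinct (concat (map fst ts)) \<and>
     distinct (map (fst \<circ> snd) ts) \<and> distinct (map (snd \<circ> snd) ts)"
proof (induction ts)
  case (Cons t ts)
  obtain p i j where t: "t = (p, i, j)"
    by (cases t) auto
  have "distinct (map Old p) \<longleftrightarrow> distinct p"
    by (simp add: distinct_map inj_on_def)
  moreover have "set (map Old p) \<inter> set (X i # Y j # join_paths ts) = {} \<longleftrightarrow>
      set p \<inter> set (concat (map fst ts)) = {}"
    using in_set_join_paths(1)[of _ ts] by (auto simp: disjoint_iff)
  ultimately show ?case
    unfolding t join_paths_Cons distinct_append using Cons.IH by (auto simp: in_set_join_paths)
qed simp

lemma path_list_of_path_cover:
  assumes "path_cover A V \<S>" and "finite \<S>"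
  obtains ps where "length ps = card \<S>" "\<forall>p\<in>set ps. dipath A p \<and> p \<noteq> []"
    "distinct (concat ps)" "set (concat ps) = V"
proof -
  have \<S>: "V = \<Union>\<S>" "disjoint \<S>" "{} \<notin> \<S>"
    using assms(1) by (auto simp: path_cover_def partition_on_def)
  obtain Ss where Ss: "set Ss = \<S>" "distinct Ss"
    using finite_distinct_list[OF assms(2)] by blast
  have "\<forall>S\<in>\<S>. \<exists>p. dipath A p \<and> set p = S"
    using assms(1) by (simp add: path_cover_def path_on_def)
  from bchoice[OF this] obtain f where f: "\<forall>S\<in>\<S>. dipath A (f S) \<and> set (f S) = S"
    by blast
  have "distinct (concat (map f Ss))"
  proof (rule distinct_concat)
    have "inj_on f \<S>"
      using f by (metis inj_onI)
    then show "distinct (map f Ss)"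
      using Ss by (simp add: distinct_map)
    show "distinct p" if "p \<in> set (map f Ss)" for p
      using that f Ss(1) by (auto simp: dipath_def)
    show "set p \<inter> set q = {}" if "p \<in> set (map f Ss)" "q \<in> set (map f Ss)" "p \<noteq> q" for p q
      using that f Ss(1) disjointD[OF \<S>(2)] by (metis imageE set_map)
  qed
  moreover have "\<forall>p\<in>set (map f Ss). dipath A p \<and> p \<noteq> []"
    using f Ss(1) \<S>(3) by auto
  moreover have "set (concat (map f Ss)) = V"
    using f Ss(1) \<S>(1) by simp
  moreover have "length (map f Ss) = card \<S>"
    using Ss distinct_card by fastforce
  ultimately show ?thesis
    by (intro that[of "map f Ss"])
qed

lemma path_cover_of_path_list:
  assumes "\<forall>p\<in>set ps. dipath A p \<and> p \<noteq> []" and "distinct (concat ps)"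
  shows "path_cover A (set (concat ps)) (set ` set ps)" and "card (set ` set ps) = length ps"
proof -
  have disj: "set p \<inter> set q = {}" if "p \<in> set ps" "q \<in> set ps" "p \<noteq> q" for p q
    using assms(2) that by (simp add: distinct_concat_iff)
  then have "disjoint (set ` set ps)"
    by (auto simp: disjoint_def)
  then show "path_cover A (set (concat ps)) (set ` set ps)"
    using assms(1) path_onI by (fastforce simp: path_cover_def partition_on_def)
  have "inj_on set (set ps)"
  proof (rule inj_onI)
    fix p q assume "p \<in> set ps" "q \<in> set ps" "set p = set q"
    then show "p = q"
      using disj[of p q] assms(1) by fastforce
  qed
  moreover have "[] \<notin> set ps"
    using assms(1) by blast
  then have "distinct ps"
    using assms(2) by (simp add: distinct_concat_iff removeAll_id)
  ultimately show "card (set ` set ps) = length ps"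
    by (simp add: card_image distinct_card)
qed

lemma cycle_on_join_paths:
  assumes paths: "\<forall>p\<in>set (map fst ts). dipath (parcs D) p \<and> p \<noteq> [] \<and> set p \<subseteq> pverts D"
    and indices: "set (map (fst \<circ> snd) ts) \<subseteq> {1..k}" "set (map (snd \<circ> snd) ts) \<subseteq> {1..k}"
    and "distinct (join_paths ts)" and "ts \<noteq> []"
  shows "cycle_on (parcs (H_ext k D)) (set (join_paths ts))"
proof -
  let ?A = "parcs (H_ext k D)"
  define ss where "ss = map (\<lambda>(p, i, j). map Old p @ [X i, Y j]) ts"
  have join: "join_paths ts = concat ss"
    by (simp add: join_paths_def ss_def)
  have piece: "s \<noteq> [] \<and> dipath ?A s \<and> (\<exists>v\<in>pverts D. hd s = Old v) \<and> (\<exists>j\<in>{1..k}. last s = Y j)"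
    if "s \<in> set ss" for s
  proof -
    obtain p i j where t: "(p, i, j) \<in> set ts" and s: "s = map Old p @ [X i, Y j]"
      using \<open>s \<in> set ss\<close> unfolding ss_def by auto
    have "p \<in> set (map fst ts)" "i \<in> set (map (fst \<circ> snd) ts)" "j \<in> set (map (snd \<circ> snd) ts)"
      using t by force+
    then have p: "dipath (parcs D) p" "p \<noteq> []" "set p \<subseteq> pverts D" "i \<in> {1..k}" "j \<in> {1..k}"
      using paths indices by blast+
    then have "hd p \<in> pverts D" "last p \<in> pverts D"
      by auto
    then show ?thesis
      using p unfolding s by (auto simp: dipath_append_iff dipath_Cons_iff hd_map last_map)
  qed
  have arc: "(last s, hd t) \<in> ?A" if "s \<in> set ss" "t \<in> set ss" for s t
    using piece[OF that(1)] piece[OF that(2)] by auto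
  have "[] \<notin> set ss" "ss \<noteq> []"
    using piece \<open>ts \<noteq> []\<close> by (auto simp: ss_def)
  moreover have "successively (\<lambda>s t. (last s, hd t) \<in> ?A) ss"
    using arc by (simp add: successively_conv_nth)
  then have "dipath ?A (concat ss)"
    using \<open>distinct (join_paths ts)\<close> piece \<open>[] \<notin> set ss\<close> by (simp add: dipath_concat_iff join)
  ultimately have "dicycle ?A (concat ss)"
    using arc by (intro dicycle_concat) simp_all
  then show ?thesis
    unfolding join by (rule cycle_onI)
qed

lemma path_cover_imp_hamiltonian_H_ext:
  assumes "path_cover (parcs D) (pverts D) \<S>" and "card \<S> = k" and "0 < k"
  shows "hamiltonian (with_proj (H_ext k D))"
proof -
  have "finite \<S>"
    using assms(2,3) card_ge_0_finite by blast
  then obtain ps where ps: "length ps = k" "\<forall>p\<in>set ps. dipath (parcs D) p \<and> p \<noteq> []"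
    "distinct (concat ps)" "set (concat ps) = pverts D"
    using path_list_of_path_cover[OF assms(1)] assms(2) by metis
  define ts where "ts = zip ps (zip [1..<Suc k] [1..<Suc k])"
  have maps: "map fst ts = ps" "map (fst \<circ> snd) ts = [1..<Suc k]" "map (snd \<circ> snd) ts = [1..<Suc k]"
    unfolding ts_def using ps(1) by (simp_all flip: map_map)
  have set_ts: "set (join_paths ts) = pverts (H_ext k D)"
  proof (rule set_eqI)
    show "x \<in> set (join_paths ts) \<longleftrightarrow> x \<in> pverts (H_ext k D)" for x
      by (cases x) (simp_all only: in_set_join_paths maps ps(4), auto simp: H_ext_verts)
  qed
  have "cycle_on (parcs (H_ext k D)) (set (join_paths ts))"
  proof (rule cycle_on_join_paths)
    show "\<forall>p\<in>set (map fst ts). dipath (parcs D) p \<and> p \<noteq> [] \<and> set p \<subseteq> pverts D"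
      unfolding maps using ps(2,4) by auto
    show "set (map (fst \<circ> snd) ts) \<subseteq> {1..k}" "set (map (snd \<circ> snd) ts) \<subseteq> {1..k}"
      unfolding maps by auto
    show "distinct (join_paths ts)"
      unfolding distinct_join_paths maps using ps(3) by simp
    show "ts \<noteq> []"
      using maps(1) ps(1) assms(3) by auto
  qed
  moreover have "finite (pverts (H_ext k D))"
    unfolding set_ts[symmetric] by simp
  then have "card {X 1, Y 1 :: 'a ext_vertex} \<le> card (pverts (H_ext k D))"
    using \<open>0 < k\<close> by (intro card_mono) (auto simp: H_ext_verts)
  ultimately show ?thesis
    unfolding set_ts by (intro cycle_on_imp_hamiltonian) simp_all
qed

lemma H_ext_dipath_is_join_paths:
  assumes "dipath (parcs (H_ext k D)) l" and "l \<noteq> []" and "hd l = Old v" and "last l = Y m"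
  shows "\<exists>ts. l = join_paths ts \<and> (\<forall>p\<in>set (map fst ts). p \<noteq> [])"
  using assms
proof (induction "length l" arbitrary: l v rule: less_induct)
  case less
  have "last l \<in> set l" "last l \<notin> range Old"
    using less.prems(2,4) last_in_set[of l] by auto
  then have "\<exists>x\<in>set l. x \<notin> range Old"
    by blast
  then obtain ys x zs where l: "l = ys @ x # zs" and x: "x \<notin> range Old"
    and ys: "\<forall>y\<in>set ys. y \<in> range Old"
    using split_list_first_prop[of l "\<lambda>x. x \<notin> range Old"] by blast
  obtain p where p: "ys = map Old p"
    using ys by (metis ex_map_conv rangeE)
  have "p \<noteq> []"
    using less.prems(3) x l p by auto
  then obtain i where i: "x = X i"
    using less.prems(1) x unfolding l p by (cases x) (auto simp: dipath_append_iff last_map)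
  obtain y ws where "zs = y # ws"
    using less.prems(4) i l by (cases zs) auto
  then obtain j where zs: "zs = Y j # ws"
    using less.prems(1) unfolding l i by (cases y) (auto simp: dipath_append_iff dipath_Cons_iff)
  show ?case
  proof (cases ws)
    case Nil
    then show ?thesis
      using l p i zs \<open>p \<noteq> []\<close> by (intro exI[of _ "[(p, i, j)]"]) simp
  next
    case (Cons w ws')
    have "dipath (parcs (H_ext k D)) ws"
      using less.prems(1) l zs by (simp add: dipath_append_iff dipath_Cons_iff)
    moreover obtain u where "hd ws = Old u"
      using less.prems(1) Cons unfolding l zs
      by (cases w) (auto simp: dipath_append_iff dipath_Cons_iff)
    moreover have "last ws = Y m"
      using less.prems(4) l zs Cons by simp
    ultimately obtain ts where "ws = join_paths ts" "\<forall>p\<in>set (map fst ts). p \<noteq> []"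
      using less.hyps[of ws] l zs Cons by auto
    then show ?thesis
      using l p i zs \<open>p \<noteq> []\<close> by (intro exI[of _ "(p, i, j) # ts"]) simp
  qed
qed

lemma dipath_of_join_paths:
  assumes "dipath (parcs (H_ext k D)) (join_paths ts)" and "p \<in> set (map fst ts)"
  shows "dipath (parcs D) p"
proof -
  obtain i j where "(p, i, j) \<in> set ts"
    using assms(2) by auto
  then have "dipath (parcs (H_ext k D)) (map Old p @ [X i, Y j])"
    using assms(1) unfolding join_paths_def by (subst (asm) dipath_concat_iff) force+
  then show ?thesis
    by (simp add: dipath_append_iff)
qed

lemma hamiltonian_H_ext_imp_path_cover:
  assumes "pair_loopfree_digraph D" and "hamiltonian (with_proj (H_ext k D))" and "0 < k"
  shows "\<exists>\<S>. path_cover (parcs D) (pverts D) \<S> \<and> card \<S> = k"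
proof -
  let ?A = "parcs (H_ext k D)"
  have "cycle_on ?A (pverts (H_ext k D))"
    using hamiltonian_imp_cycle_on(1)[OF loopfree_H_ext[OF assms(1)] assms(2)] .
  moreover have "Y 1 \<in> pverts (H_ext k D)" "X 1 \<in> pverts (H_ext k D)"
    using \<open>0 < k\<close> by (auto simp: H_ext_verts)
  ultimately obtain l where l: "dicycle ?A (l @ [Y 1])" "set (l @ [Y 1]) = pverts (H_ext k D)"
    using cycle_on_lastE by metis
  then have path: "dipath ?A (l @ [Y 1])" and "l \<noteq> []"
    using \<open>X 1 \<in> _\<close> by (auto simp: dicycle_def)
  then have "(Y 1, hd (l @ [Y 1])) \<in> ?A"
    using l(1) by (cases l) (auto simp: dicycle_def)
  then obtain v where hd: "hd (l @ [Y 1]) = Old v"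
    by (cases "hd (l @ [Y 1])") auto
  have "\<exists>ts. l @ [Y 1] = join_paths ts \<and> (\<forall>p\<in>set (map fst ts). p \<noteq> [])"
    by (rule H_ext_dipath_is_join_paths[OF path _ hd]) simp_all
  then obtain ts where ts: "l @ [Y 1] = join_paths ts" "\<forall>p\<in>set (map fst ts). p \<noteq> []"
    by blast
  have dist: "distinct (concat (map fst ts))" "distinct (map (fst \<circ> snd) ts)"
    using path unfolding ts(1) by (simp_all add: dipath_def distinct_join_paths)
  have verts: "x \<in> set (join_paths ts) \<longleftrightarrow> x \<in> pverts (H_ext k D)" for x
    unfolding ts(1)[symmetric] l(2) ..
  have "set (concat (map fst ts)) = pverts D"
    unfolding set_eq_iff in_set_join_paths(1)[symmetric] verts by (auto simp: H_ext_verts)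
  moreover have "set (map (fst \<circ> snd) ts) = {1..k}"
    unfolding set_eq_iff in_set_join_paths(2)[symmetric] verts by (auto simp: H_ext_verts)
  then have "length (map fst ts) = k"
    using distinct_card[OF dist(2)] by simp
  moreover have "\<forall>p\<in>set (map fst ts). dipath (parcs D) p \<and> p \<noteq> []"
    using ts(2) dipath_of_join_paths path unfolding ts(1) by blast
  ultimately show ?thesis
    using path_cover_of_path_list[OF _ dist(1)] by metis
qed

theorem hamiltonian_H_ext_iff:
  assumes "pair_loopfree_digraph D"
  shows "hamiltonian (with_proj (H_ext k D)) \<longleftrightarrow> cycle_or_path_cover (parcs D) (pverts D) k"
proof (cases "k = 0")
  case True
  have "pverts (H_ext 0 D) = Old ` pverts D" "card (Old ` pverts D) = card (pverts D)"
    by (simp_all add: H_ext_verts card_image inj_on_def)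
  then show ?thesis
    using hamiltonian_imp_cycle_on[OF loopfree_H_ext[OF assms], of 0]
      cycle_on_imp_hamiltonian[of "H_ext 0 D"] True
    by (auto simp: cycle_or_path_cover_def cycle_on_Old_image)
next
  case False
  then show ?thesis
    using hamiltonian_H_ext_imp_path_cover[OF assms] path_cover_imp_hamiltonian_H_ext
    by (auto simp: cycle_or_path_cover_def)
qed

section \<open>Strong spanning subdigraphs\<close>

lemma spanning_strongly_connected_imp_strong_on:
  assumes "spanning S (with_proj D)" and "strongly_connected S"
  shows "strong_on (pverts D) (arcs S)" and "arcs S \<subseteq> parcs D"
proof -
  have sub: "subgraph S (with_proj D)" and verts: "verts S = pverts D"
    using assms(1) by (auto simp: spanning_def)
  then have "tail S = fst" "head S = snd" and "arcs S \<subseteq> parcs D"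
    by (auto simp: subgraph_def compatible_def)
  then have "arcs_ends S = arcs S"
    by (auto simp: arcs_ends_def arc_to_ends_def)
  moreover have "(u, v) \<in> (arcs_ends S)\<^sup>*" if "u \<rightarrow>\<^sup>*\<^bsub>S\<^esub> v" for u v
    using that unfolding reachable_def by (rule rtrancl_on_rtranclI)
  ultimately show "strong_on (pverts D) (arcs S)"
    using assms(2) verts unfolding strongly_connected_def strong_on_def by auto
  show "arcs S \<subseteq> parcs D" by fact
qed

lemma strong_on_imp_spanning_strongly_connected:
  assumes "pair_wf_digraph D" and "B \<subseteq> parcs D" and "strong_on (pverts D) B" and "pverts D \<noteq> {}"
  shows "\<exists>S. spanning S (with_proj D) \<and> strongly_connected S \<and> arcs S = B"
proof -
  interpret D: pair_wf_digraph D by (rule assms(1))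
  let ?S = "with_proj \<lparr>pverts = pverts D, parcs = B\<rparr>"
  have wf: "wf_digraph ?S"
    using assms(2) D.wellformed' by unfold_locales auto
  then interpret S: wf_digraph ?S .
  have "spanning ?S (with_proj D)"
    using assms(2) wf D.wf_digraph_axioms by (auto simp: spanning_def subgraph_def compatible_def)
  moreover have "u \<rightarrow>\<^sup>*\<^bsub>?S\<^esub> v" if "u \<in> pverts D" "v \<in> pverts D" for u v
  proof -
    have "(u, v) \<in> (arcs_ends ?S)\<^sup>*"
      using assms(3) that by (simp add: strong_on_def)
    then show ?thesis
    proof (induction rule: rtrancl_induct)
      case base
      then show ?case using that by (intro S.reachable_refl) simp
    next
      case (step y z)
      then show ?case by (meson S.reachable_adj_trans)
    qed
  qed
  ultimately show ?thesis
    using assms(4) by (intro exI[of _ ?S]) (auto simp: strongly_connected_def)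
qed

lemma strong_spanning_imp_ear_decomposition:
  assumes "pair_fin_digraph D" and "2 \<le> card (pverts D)"
    and "spanning S (with_proj D)" and "strongly_connected S"
  shows "\<exists>j. ear_decomposition (parcs D) (pverts D) j \<and> card (pverts D) + j \<le> card (arcs S)"
proof -
  interpret pair_fin_digraph D by (rule assms(1))
  note S = spanning_strongly_connected_imp_strong_on[OF assms(3,4)]
  then have "arcs S \<subseteq> pverts D \<times> pverts D"
    using wellformed' by auto
  then obtain j where j: "ear_decomposition (arcs S) (pverts D) j"
    using strong_on_imp_ear_decomposition[OF S(1) _ assms(2)] by blast
  obtain B where "B \<subseteq> arcs S" "card B = card (pverts D) + j"
    using ear_decomposition_strong_subdigraph[OF j] by blast
  moreover have "finite (arcs S)"
    using S(2) pair_finite_arcs by (rule finite_subset)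
  ultimately have "card (pverts D) + j \<le> card (arcs S)"
    by (metis card_mono)
  then show ?thesis
    using ear_decomposition_mono[OF j S(2)] by blast
qed

lemma ear_decomposition_imp_strong_spanning:
  assumes "pair_wf_digraph D" and "ear_decomposition (parcs D) (pverts D) j" and "pverts D \<noteq> {}"
  shows "\<exists>S. spanning S (with_proj D) \<and> strongly_connected S \<and> card (arcs S) = card (pverts D) + j"
proof -
  obtain B where "B \<subseteq> parcs D" "card B = card (pverts D) + j" "strong_on (pverts D) B"
    using ear_decomposition_strong_subdigraph[OF assms(2)] by blast
  then show ?thesis
    using strong_on_imp_spanning_strongly_connected[OF assms(1) _ _ assms(3)] by metis
qed

theorem smallest_strong_spanning_subdigraph_card:
  assumes D: "pair_fin_digraph D" "2 \<le> card (pverts D)"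
    and m: "ear_decomposition (parcs D) (pverts D) m"
    and least: "\<And>j. ear_decomposition (parcs D) (pverts D) j \<Longrightarrow> m \<le> j"
  shows "(\<exists>S. smallest_strong_spanning_subdigraph S (with_proj D)) \<and>
    (\<forall>S. smallest_strong_spanning_subdigraph S (with_proj D) \<longrightarrow>
      card (arcs S) = card (pverts D) + m)"
proof -
  have lower: "card (pverts D) + m \<le> card (arcs S)"
    if S: "spanning S (with_proj D)" "strongly_connected S" for S
  proof -
    obtain j where "ear_decomposition (parcs D) (pverts D) j" "card (pverts D) + j \<le> card (arcs S)"
      using strong_spanning_imp_ear_decomposition[OF D S] by blast
    then show ?thesis
      using least[of j] by simp
  qed
  have "pair_wf_digraph D" "pverts D \<noteq> {}"
    using D by (auto simp: pair_fin_digraph_def)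
  then obtain S where S: "spanning S (with_proj D)" "strongly_connected S"
      "card (arcs S) = card (pverts D) + m"
    using ear_decomposition_imp_strong_spanning[OF _ m] by blast
  then have "smallest_strong_spanning_subdigraph S (with_proj D)"
    using lower by (simp add: smallest_strong_spanning_subdigraph_def)
  moreover have "card (arcs S') = card (pverts D) + m"
    if "smallest_strong_spanning_subdigraph S' (with_proj D)" for S'
    using that S lower[of S'] unfolding smallest_strong_spanning_subdigraph_def
    by (metis le_antisym)
  ultimately show ?thesis by blast
qed

lemma ear_decomposition_epsilon:
  assumes D: "pair_loopfree_digraph D" and "ear_decomposition (parcs D) (pverts D) i"
    and cover: "\<And>k. cycle_or_path_cover (parcs D) (pverts D) k \<Longrightarrow>
      \<exists>j\<le>k. ear_decomposition (parcs D) (pverts D) j"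
  shows "ear_decomposition (parcs D) (pverts D) (epsilon D)"
    and "\<And>j. ear_decomposition (parcs D) (pverts D) j \<Longrightarrow> epsilon D \<le> j"
proof -
  have eps: "epsilon D = (LEAST k. cycle_or_path_cover (parcs D) (pverts D) k)"
    by (simp add: epsilon_def hamiltonian_H_ext_iff[OF D])
  show least: "epsilon D \<le> j" if "ear_decomposition (parcs D) (pverts D) j" for j
    unfolding eps using ear_decomposition_imp_cycle_or_path_cover[OF that] by (rule Least_le)
  have "cycle_or_path_cover (parcs D) (pverts D) (epsilon D)"
    unfolding eps using ear_decomposition_imp_cycle_or_path_cover[OF assms(2)] by (rule LeastI)
  then obtain j where "j \<le> epsilon D" "ear_decomposition (parcs D) (pverts D) j"
    using cover by blast
  then show "ear_decomposition (parcs D) (pverts D) (epsilon D)"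
    using least[of j] by (metis le_antisym)
qed

section \<open>Compositions of digraphs\<close>

locale digraph_composition =
  fixes T :: "'b pair_pre_digraph" and H :: "'b \<Rightarrow> 'a pair_pre_digraph"
  assumes digraph_T: "pair_digraph T"
    and digraph_H: "u \<in> pverts T \<Longrightarrow> pair_digraph (H u)"
    and nonempty_H: "u \<in> pverts T \<Longrightarrow> pverts (H u) \<noteq> {}"
    and disjoint_H: "disjoint_family_on (\<lambda>u. pverts (H u)) (pverts T)"
begin

sublocale T: pair_digraph T
  by (rule digraph_T)

abbreviation Q :: "'a pair_pre_digraph" where
  "Q \<equiv> composition T H"

definition part :: "'a \<Rightarrow> 'b" where
  "part x = (THE u. u \<in> pverts T \<and> x \<in> pverts (H u))"

lemma part_eq:
  assumes "u \<in> pverts T" and "x \<in> pverts (H u)"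
  shows "part x = u"
  unfolding part_def
  using assms disjoint_H by (intro the_equality) (auto simp: disjoint_family_on_def)

lemma pverts_composition: "x \<in> pverts Q \<longleftrightarrow> part x \<in> pverts T \<and> x \<in> pverts (H (part x))"
  using part_eq by (auto simp: composition_def)

lemma parcs_composition_cases:
  assumes "(x, y) \<in> parcs Q"
  obtains (inside) u where "u \<in> pverts T" "(x, y) \<in> parcs (H u)"
      "x \<in> pverts (H u)" "y \<in> pverts (H u)" "x \<noteq> y"
    | (across) u w where "(u, w) \<in> parcs T" "u \<in> pverts T" "w \<in> pverts T"
      "x \<in> pverts (H u)" "y \<in> pverts (H w)"
proof -
  consider u where "u \<in> pverts T" "(x, y) \<in> parcs (H u)"
    | u w where "(u, w) \<in> parcs T" "x \<in> pverts (H u)" "y \<in> pverts (H w)"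
    using assms unfolding composition_def by auto
  then show ?thesis
  proof cases
    case (1 u)
    interpret Hu: pair_digraph "H u"
      using digraph_H 1(1) .
    show ?thesis
      using inside[OF 1] Hu.wellformed'[OF 1(2)] Hu.pair_no_loops[OF 1(2)] by simp
  next
    case (2 u w)
    then show ?thesis
      using across T.wellformed'[OF 2(1)] by blast
  qed
qed

lemma part_arc:
  assumes "(x, y) \<in> parcs Q" and "part x \<noteq> part y"
  shows "(part x, part y) \<in> parcs T"
  using assms(1)
proof (cases rule: parcs_composition_cases)
  case (inside u)
  then show ?thesis using assms(2) part_eq by metis
next
  case (across u w)
  then show ?thesis using part_eq by metis
qed

lemma arc_if_part_arc:
  assumes "x \<in> pverts Q" and "y \<in> pverts Q" and "(part x, part y) \<in> parcs T"
  shows "(x, y) \<in> parcs Q"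
proof -
  have "x \<in> pverts (H (part x))" "y \<in> pverts (H (part y))"
    using assms(1,2) pverts_composition by blast+
  then show ?thesis
    using assms(3) unfolding composition_def by auto
qed

lemma image_part: "part ` pverts Q = pverts T"
proof
  show "part ` pverts Q \<subseteq> pverts T"
    using pverts_composition by blast
  show "pverts T \<subseteq> part ` pverts Q"
  proof
    fix u assume u: "u \<in> pverts T"
    then obtain x where x: "x \<in> pverts (H u)"
      using nonempty_H by blast
    then have "x \<in> pverts Q" "part x = u"
      using u part_eq pverts_composition by auto
    then show "u \<in> part ` pverts Q" by blast
  qed
qed

lemma pair_digraph_composition: "pair_digraph Q"
proof -
  have wf: "x \<in> pverts Q" "y \<in> pverts Q" "x \<noteq> y" if "(x, y) \<in> parcs Q" for x y
  proof -
    show "x \<in> pverts Q" "y \<in> pverts Q"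
      using that by (cases rule: parcs_composition_cases; auto simp: composition_def)+
    show "x \<noteq> y"
      using that
    proof (cases rule: parcs_composition_cases)
      case (across u w)
      then have "part x = u" "part y = w" "u \<noteq> w"
        using part_eq T.pair_no_loops[OF across(1)] by simp_all
      then show ?thesis by blast
    qed
  qed
  have "finite (pverts (H u))" if "u \<in> pverts T" for u
    using digraph_H[OF that] pair_digraph.axioms(1) pair_fin_digraph.pair_finite_verts by blast
  then have fin: "finite (pverts Q)"
    by (simp add: composition_def)
  moreover have "parcs Q \<subseteq> pverts Q \<times> pverts Q"
    using wf by auto
  then have "finite (parcs Q)"
    using fin finite_subset by blast
  ultimately show ?thesis
    using wf by unfold_locales auto
qed

lemma strong_on_T:
  assumes "strong_on (pverts Q) (parcs Q)"
  shows "strong_on (pverts T) (parcs T)"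
proof -
  have "(part x, part y) \<in> (parcs T)\<^sup>*" if "(x, y) \<in> (parcs Q)\<^sup>*" for x y
    using that
  proof (induction rule: rtrancl_induct)
    case (step y z)
    then show ?case
      using part_arc[OF step.hyps(2)] by (cases "part y = part z") auto
  qed simp
  then show ?thesis
    using assms unfolding strong_on_def image_part[symmetric] by blast
qed

lemma semicomplete_composition_part:
  assumes "2 \<le> card (pverts T)" and "semicomplete T" and "strong_on (pverts Q) (parcs Q)"
  shows "semicomplete_composition (parcs T) (pverts T) part (parcs Q) (pverts Q)"
proof unfold_locales
  show "parcs T \<subseteq> pverts T \<times> pverts T"
    using T.wellformed' by auto
  show "(u, u) \<notin> parcs T" for u
    using T.pair_no_loops[of "(u, u)"] by auto
  show "u \<in> pverts T \<Longrightarrow> v \<in> pverts T \<Longrightarrow> u \<noteq> v \<Longrightarrow> (u, v) \<in> parcs T \<or> (v, u) \<in> parcs T" for u v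
    using assms(2) by (simp add: semicomplete_def)
  show "2 \<le> card (pverts T)"
    by (rule assms(1))
qed (use strong_on_T[OF assms(3)] image_part part_arc arc_if_part_arc in auto)

end

theorem theorem5p8:
  fixes T :: "'b pair_pre_digraph"
    and H :: "'b \<Rightarrow> 'a pair_pre_digraph"
    and Q :: "'a pair_pre_digraph"
    and n :: nat
  assumes "pair_digraph T"
    and "card (pverts T) \<ge> 2"
    and "semicomplete T"
    and "\<And>u. u \<in> pverts T \<Longrightarrow> pair_digraph (H u)"
    and "\<And>u. u \<in> pverts T \<Longrightarrow> pverts (H u) \<noteq> {}"
    and "disjoint_family_on (\<lambda>u. pverts (H u)) (pverts T)"
    and "Q = composition T H"
    and "strongly_connected (with_proj Q)"
    and "n = card (pverts Q)"
  shows "(\<exists>S. smallest_strong_spanning_subdigraph S (with_proj Q)) \<and>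
         (\<forall>S. smallest_strong_spanning_subdigraph S (with_proj Q) \<longrightarrow>
              card (arcs S) = n + epsilon Q)"
proof -
  interpret comp: digraph_composition T H
    by (intro digraph_composition.intro assms(1,4-6))
  interpret Q: pair_digraph Q
    using comp.pair_digraph_composition assms(7) by simp
  have spanning: "spanning (with_proj Q) (with_proj Q)"
    using Q.wf_digraph_axioms by (auto simp: spanning_def subgraph_def compatible_def)
  interpret semicomplete_composition "parcs T" "pverts T" comp.part "parcs Q" "pverts Q"
    using comp.semicomplete_composition_part[OF assms(2,3)] assms(7)
      spanning_strongly_connected_imp_strong_on(1)[OF spanning assms(8)] by simp
  have card: "2 \<le> card (pverts Q)"
    using card_P image_V card_image_le[OF Q.pair_finite_verts, of comp.part] by simp
  obtain i where "ear_decomposition (parcs Q) (pverts Q) i"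
    using strong_spanning_imp_ear_decomposition[OF Q.pair_fin_digraph_axioms card spanning assms(8)]
    by blast
  note eps = ear_decomposition_epsilon[OF Q.pair_loopfree_digraph_axioms this
      cycle_or_path_cover_imp_ear_decomposition]
  show ?thesis
    unfolding assms(9)
    by (rule smallest_strong_spanning_subdigraph_card[OF Q.pair_fin_digraph_axioms card eps])
qed

end
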